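(* Let $f:\mathbb{R}^d\to\mathbb{R}$ be differentiable and (weakly) convex with a minimizer $x^*$. Let $(X_t,Y_t)_{t\ge0}$ evolve following the randomized Hamiltonian flow (RHF) with refreshment rate $\gamma(t)=\frac{6}{t+1}$, from any $X_0\in\mathbb{R}^d$ with $Y_0=0$. Then for any $t\ge0$, $$\mathbb{E}\left[f(X_t)-f(x^* )\right]\le \frac{5\cdot\mathbb{E}\left[f(X_0)-f(x^* )+\|X_0-x^*\|^2\right]}{(t+1)^2}.$$
   Context: $\|\cdot\|$ is the Euclidean norm. A differentiable $f$ is (weakly) convex if $f(y)\ge f(x)+\langle\nabla f(x),y-x\rangle$ for all $x,y\in\mathbb{R}^d$. Hamiltonian flow (HF): the ODE system $\dot X_t=Y_t$, $\dot Y_t=-\nabla f(X_t)$ on $\mathbb{R}^d\times\mathbb{R}^d$; it is taken to have a well-defined flow map (a unique solution for all $t\ge 0$ from every initial condition). Randomized Hamiltonian flow (RHF) with rate $\gamma(t)>0$: the piecewise deterministic stochastic process $$dX_t=Y_t\,dt,\qquad dY_t=-\nabla f(X_t)\,dt-Y_{t}\,dN_t,$$ where $dN_t=\sum_{k\ge1}\delta_{T_k}(dt)$ is a Poisson point process on $[0,\infty)$ with (possibly time-dependent) rate $\gamma(t)$ and event times $T_1<T_2<\cdots$, and the value of $Y$ multiplying $dN_t$ is its left limit. That is, $(X_t,Y_t)$ follows (HF) between consecutive event times, $X_t$ is continuous, and at each event time $T_k$ the velocity is reset: $Y_{T_k}=0$. The expectation is over the random event times (for deterministic $X_0$ the expectation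 on the right-hand side is trivial). *)

theory Defs
  imports "HOL-Probability.Probability"
begin

definition gradient :: "('a::euclidean_space \<Rightarrow> real) \<Rightarrow> 'a \<Rightarrow> 'a" where
  "gradient f x = (THE D. GDERIV f x :> D)"

definition weakly_convex :: "('a::euclidean_space \<Rightarrow> real) \<Rightarrow> bool" where
  "weakly_convex f \<longleftrightarrow> (\<forall>x y. f y \<ge> f x + inner (gradient f x) (y - x))"

(* The derivatives are taken within S, hence one-sided at an end point that belongs to S. *)
definition hamiltonian_flow_on ::
    "('a::euclidean_space \<Rightarrow> real) \<Rightarrow> real set \<Rightarrow> (real \<Rightarrow> 'a) \<Rightarrow> (real \<Rightarrow> 'a) \<Rightarrow> bool" where
  "hamiltonian_flow_on f S X Y \<longleftrightarrow>
     (\<forall>t\<in>S. (X has_vector_derivative Y t) (at t within S) \<and>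
            (Y has_vector_derivative - gradient f (X t)) (at t within S))"

(* Solutions are total functions on the reals, so uniqueness is only required on {0..}. *)
definition well_defined_flow :: "('a::euclidean_space \<Rightarrow> real) \<Rightarrow> bool" where
  "well_defined_flow f \<longleftrightarrow>
     (\<forall>x y. \<exists>X Y. hamiltonian_flow_on f {0..} X Y \<and> X 0 = x \<and> Y 0 = y \<and>
        (\<forall>X' Y'. hamiltonian_flow_on f {0..} X' Y' \<and> X' 0 = x \<and> Y' 0 = y \<longrightarrow>
           (\<forall>t\<ge>0. X' t = X t \<and> Y' t = Y t)))"

definition event_count :: "(nat \<Rightarrow> 'w \<Rightarrow> real) \<Rightarrow> real set \<Rightarrow> 'w \<Rightarrow> nat" where
  "event_count T A \<omega> = card {k. T k \<omega> \<in> A}"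

(* The events are indexed from 0, so T k is the (k+1)-st event time. Since the event times
   tend to infinity almost surely, the cardinality in event_count is almost surely that of
   a finite set when A is bounded. The probabilities are written out because poisson_pmf
   requires a positive parameter, whereas the integral of the rate is 0 when A is a null set. *)
definition poisson_point_process ::
    "'w measure \<Rightarrow> (real \<Rightarrow> real) \<Rightarrow> (nat \<Rightarrow> 'w \<Rightarrow> real) \<Rightarrow> bool" where
  "poisson_point_process M \<gamma> T \<longleftrightarrow>
     (\<forall>t\<ge>0. \<gamma> t > 0) \<and> (\<forall>b. set_integrable lborel {0..b} \<gamma>) \<and>
     (\<forall>k. T k \<in> borel_measurable M) \<and>
     (AE \<omega> in M. 0 \<le> T 0 \<omega> \<and> strict_mono (\<lambda>k. T k \<omega>) \<and> filterlim (\<lambda>k. T k \<omega>) at_top sequentially) \<and>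
     (\<forall>A\<in>sets borel. A \<subseteq> {0..} \<and> bounded A \<longrightarrow>
        (\<forall>n. measure M {\<omega>\<in>space M. event_count T A \<omega> = n} =
             (LINT t:A|lborel. \<gamma> t) ^ n / fact n * exp (- (LINT t:A|lborel. \<gamma> t)))) \<and>
     (\<forall>n (A :: nat \<Rightarrow> real set).
        (\<forall>i<n. A i \<in> sets borel \<and> A i \<subseteq> {0..} \<and> bounded (A i)) \<and> disjoint_family_on A {..<n} \<longrightarrow>
        prob_space.indep_vars M (\<lambda>_. count_space UNIV) (\<lambda>i. event_count T (A i)) {..<n})"

(* On the half-open intervals {\<tau> k..<\<tau> (Suc k)} the derivatives at the left end point are
   right derivatives, so Y is right continuous with value 0 at \<tau> k; the velocity may
   jump only at event times. *)
definition randomized_hamiltonian_path ::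
    "('a::euclidean_space \<Rightarrow> real) \<Rightarrow> (nat \<Rightarrow> real) \<Rightarrow> (real \<Rightarrow> 'a) \<Rightarrow> (real \<Rightarrow> 'a) \<Rightarrow> bool" where
  "randomized_hamiltonian_path f \<tau> X Y \<longleftrightarrow>
     continuous_on {0..} X \<and>
     hamiltonian_flow_on f {0..<\<tau> 0} X Y \<and>
     (\<forall>k. hamiltonian_flow_on f {\<tau> k..<\<tau> (Suc k)} X Y) \<and>
     (\<forall>k. Y (\<tau> k) = 0)"

definition randomized_hamiltonian_flow ::
    "'w measure \<Rightarrow> ('a::euclidean_space \<Rightarrow> real) \<Rightarrow> (real \<Rightarrow> real) \<Rightarrow> (nat \<Rightarrow> 'w \<Rightarrow> real) \<Rightarrow>
     (real \<Rightarrow> 'w \<Rightarrow> 'a) \<Rightarrow> (real \<Rightarrow> 'w \<Rightarrow> 'a) \<Rightarrow> bool" where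
  "randomized_hamiltonian_flow M f \<gamma> T X Y \<longleftrightarrow>
     poisson_point_process M \<gamma> T \<and>
     (\<forall>t\<ge>0. X t \<in> borel_measurable M \<and> Y t \<in> borel_measurable M) \<and>
     (AE \<omega> in M. randomized_hamiltonian_path f (\<lambda>k. T k \<omega>) (\<lambda>t. X t \<omega>) (\<lambda>t. Y t \<omega>))"

end

theory Submission
  imports Defs "HOL-Complex_Analysis.Great_Picard"
begin

text \<open>
  Write \<open>s = t + 1\<close> and consider the Lyapunov function
  \<open>\<phi>(s, x, y) = s\<^sup>2 (f x - f x*) + s\<^sup>2/2 |y|\<^sup>2 + 2 s \<langle>y, x - x*\<rangle> + 5 |x - x*|\<^sup>2\<close>.
  By convexity its derivative along the Hamiltonian flow is at most
  \<open>K = 3 s |y|\<^sup>2 + 12 \<langle>y, x - x*\<rangle>\<close>, while resetting the velocity lowers it by exactly \<open>s/6 K\<close>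
  (\<open>lyapunov_step\<close>, \<open>lyapunov_refresh\<close>). Resets arrive at rate \<open>6/s\<close>, so the two effects cancel and
  \<open>\<phi>\<close> does not increase in expectation. Since \<open>\<phi> \<ge> s\<^sup>2 (f x - f x*)\<close>, and \<open>\<phi>\<close> starts at
  \<open>f x0 - f x* + 5 |x0 - x*|\<^sup>2\<close>, the claim follows.

  To make the cancellation rigorous from the independence of finitely many event counts, the process is
  compared with a chain on a grid of width \<open>h\<close>, whose velocity is reset at the end of every cell that
  contains an event (\<open>grid_chain\<close>). The state of the chain before a cell depends only on the counts
  in earlier cells, so it is independent of the count in this cell, and the expectation of \<open>\<phi>\<close>
  changes by \<open>O(h\<^sup>2)\<close> per step (\<open>expectation_lyapunov_grid_chain\<close>). The constant is uniform because the
  energy \<open>f x - f x* + |y|\<^sup>2/2\<close> never increases.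

  It remains to let \<open>h\<close> tend to \<open>0\<close>. The chain follows the same dynamics as the process, with event times
  rounded up to the grid, so it converges to the process once the flow map is known to be jointly
  continuous (\<open>flow_tendsto\<close>, \<open>grid_chain_tendsto_path\<close>). Continuity of the flow map follows from uniqueness
  of solutions by a compactness argument, which uses that the gradient of a differentiable
  convex function is continuous. Dominated convergence then transfers the bound.
\<close>


section \<open>Limits of solutions and gradients\<close>

lemma vector_derivative_lipschitz:
  assumes "convex S"
    and "\<And>t. t \<in> S \<Longrightarrow> (f has_vector_derivative f' t) (at t within S)"
    and "\<And>t. t \<in> S \<Longrightarrow> norm (f' t) \<le> B"
    and "s \<in> S" "t \<in> S"
  shows "norm (f s - f t) \<le> B * \<bar>s - t\<bar>"
proof -
  have "onorm (\<lambda>h. h *\<^sub>R f' u) \<le> B" if "u \<in> S" for u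
    by (rule onorm_le) (use assms(3)[OF that] in \<open>simp add: mult.commute[of "\<bar>_\<bar>"] mult_right_mono\<close>)
  then have "norm (f s - f t) \<le> B * norm (s - t)"
    using assms(2) unfolding has_vector_derivative_def
    by (intro differentiable_bound[OF assms(1) _ _ assms(4,5)]) auto
  then show ?thesis by simp
qed

text \<open>
  This lets a uniform limit of solutions of the differential equation be recognised as a solution.
\<close>

lemma has_vector_derivative_uniform_limit:
  fixes F :: "nat \<Rightarrow> real \<Rightarrow> 'a::banach"
  assumes S: "convex S"
    and der: "\<And>n t. t \<in> S \<Longrightarrow> (F n has_vector_derivative F' n t) (at t within S)"
    and F: "\<And>t. t \<in> S \<Longrightarrow> (\<lambda>n. F n t) \<longlonglongrightarrow> g t"
    and F': "uniform_limit S F' g' sequentially"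
    and t: "t \<in> S"
  shows "(g has_vector_derivative g' t) (at t within S)"
proof -
  have "\<exists>G. \<forall>x\<in>S. (\<lambda>n. F n x) \<longlonglongrightarrow> G x \<and> (G has_derivative (\<lambda>h. h *\<^sub>R g' x)) (at x within S)"
  proof (rule has_derivative_sequence[where f=F and f'="\<lambda>n x h. h *\<^sub>R F' n x", OF S _ _ t F[OF t]])
    show "(F n has_derivative (\<lambda>h. h *\<^sub>R F' n x)) (at x within S)" if "x \<in> S" for n x
      using der[OF that] by (simp add: has_vector_derivative_def)
    show "\<forall>\<^sub>F n in sequentially. \<forall>x\<in>S. \<forall>h. norm (h *\<^sub>R F' n x - h *\<^sub>R g' x) \<le> e * norm h" if "e > 0" for e
      using uniform_limitD[OF F' that]
    proof (eventually_elim, intro ballI allI)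
      fix n x h assume "\<forall>x\<in>S. dist (F' n x) (g' x) < e" "x \<in> S"
      then have "norm (F' n x - g' x) \<le> e" by (force simp: dist_norm)
      then show "norm (h *\<^sub>R F' n x - h *\<^sub>R g' x) \<le> e * norm h"
        by (simp add: scaleR_diff_right[symmetric] mult.commute[of "\<bar>_\<bar>"] mult_right_mono)
    qed
  qed
  then obtain G where G: "\<And>x. x \<in> S \<Longrightarrow> (\<lambda>n. F n x) \<longlonglongrightarrow> G x"
    "\<And>x. x \<in> S \<Longrightarrow> (G has_vector_derivative g' x) (at x within S)"
    by (auto simp: has_vector_derivative_def)
  show ?thesis
    by (rule has_vector_derivative_transform[OF t _ G(2)[OF t]]) (use G(1) F LIMSEQ_unique in blast)
qed

lemma tendsto_imp_norm_bounded:
  fixes a :: "nat \<Rightarrow> 'a::real_normed_vector"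
  assumes "a \<longlonglongrightarrow> L"
  obtains C where "C > 0" "\<And>n. norm (a n) \<le> C"
  using convergent_imp_Bseq[OF convergentI[OF assms]] unfolding Bseq_def by blast

lemma tendsto_imp_bounded_above:
  fixes a :: "nat \<Rightarrow> real"
  assumes "a \<longlonglongrightarrow> L"
  obtains C where "C > 0" "\<And>n. a n \<le> C"
proof -
  obtain C where C: "C > 0" "\<And>n. norm (a n) \<le> C"
    using tendsto_imp_norm_bounded[OF assms] by blast
  have "a n \<le> C" for n using C(2)[of n] by simp
  with C(1) show ?thesis by (rule that)
qed

lemma not_tendsto_subsequence:
  fixes a :: "nat \<Rightarrow> 'a::metric_space"
  assumes "\<not> a \<longlonglongrightarrow> L"
  obtains e r where "e > 0" "strict_mono (r :: nat \<Rightarrow> nat)" "\<And>n. e \<le> dist (a (r n)) L"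
proof -
  obtain e where e: "e > 0" "\<not> (\<exists>N. \<forall>n\<ge>N. dist (a n) L < e)"
    using assms unfolding lim_sequentially by blast
  then have inf: "infinite {n. e \<le> dist (a n) L}"
    unfolding infinite_nat_iff_unbounded_le by (force simp: not_less)
  from infinite_enumerate[OF this] obtain r :: "nat \<Rightarrow> nat"
    where r: "strict_mono r" "\<And>n. r n \<in> {n. e \<le> dist (a n) L}"
    by auto
  show ?thesis
    by (rule that[OF e(1) r(1)]) (use r(2) in simp)
qed

lemma inner_has_real_derivative:
  assumes "(u has_vector_derivative u') (at t within S)" "(v has_vector_derivative v') (at t within S)"
  shows "((\<lambda>t. inner (u t) (v t)) has_real_derivative inner (u t) v' + inner u' (v t)) (at t within S)"
  using bounded_bilinear.has_vector_derivative[OF bounded_bilinear_inner assms]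
  by (simp add: has_real_derivative_iff_has_vector_derivative)

text \<open>
  In finite dimension the derivative is represented by the vector of its values on the basis, so the
  description that defines \<^const>\<open>gradient\<close> picks out an existing and unique vector.
\<close>

lemma differentiable_imp_gderiv_gradient:
  fixes f :: "'a::euclidean_space \<Rightarrow> real"
  assumes "f differentiable at x"
  shows "GDERIV f x :> gradient f x"
proof -
  obtain f' where f': "(f has_derivative f') (at x)"
    using assms by (auto simp: differentiable_def)
  interpret bounded_linear f' using f' by (rule has_derivative_bounded_linear)
  define D where "D = (\<Sum>b\<in>Basis. f' b *\<^sub>R b)"
  have "f' = (\<lambda>h. inner h D)"
  proof
    fix h
    have "f' h = f' (\<Sum>b\<in>Basis. inner h b *\<^sub>R b)"
      by (simp add: euclidean_representation)
    also have "\<dots> = inner h D"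
      by (simp add: D_def sum scaleR inner_sum_right mult.commute)
    finally show "f' h = inner h D" .
  qed
  then have D: "GDERIV f x :> D"
    using f' by (simp add: gderiv_def)
  have "E = D" if "GDERIV f x :> E" for E
  proof -
    have "(\<lambda>h. inner h E) = (\<lambda>h. inner h D)"
      using that D unfolding gderiv_def by (rule has_derivative_unique)
    then show ?thesis by (metis inner_commute vector_eq_rdot)
  qed
  with D show ?thesis
    unfolding gradient_def by (rule theI)
qed


section \<open>The Hamiltonian flow of a convex function\<close>

text \<open>
  The choice may differ from other solutions at negative times; all statements below concern
  \<open>t \<ge> 0\<close>, where well-definedness of the flow makes the solution unique.
\<close>

definition hamiltonian_flow_map :: "('a::euclidean_space \<Rightarrow> real) \<Rightarrow> real \<Rightarrow> 'a \<times> 'a \<Rightarrow> 'a \<times> 'a" where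
  "hamiltonian_flow_map f t z =
     (SOME P. hamiltonian_flow_on f {0..} (fst \<circ> P) (snd \<circ> P) \<and> P 0 = z) t"

locale convex_hamiltonian_system =
  fixes f :: "'a::euclidean_space \<Rightarrow> real" and xstar :: 'a
  assumes differentiable: "f differentiable_on UNIV"
    and convex: "weakly_convex f"
    and minimizer: "\<And>x. f xstar \<le> f x"
    and well_defined: "well_defined_flow f"
begin

abbreviation flow where "flow \<equiv> hamiltonian_flow_map f"

lemma gderiv: "GDERIV f x :> gradient f x"
  using differentiable
  by (intro differentiable_imp_gderiv_gradient) (simp add: differentiable_on_def)

lemma gradient_ineq: "f x + inner (gradient f x) (y - x) \<le> f y"
  using convex by (simp add: weakly_convex_def)

lemma continuous_on_f: "continuous_on S f"
  using differentiable differentiable_imp_continuous_on continuous_on_subset by blast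

text \<open>
  A differentiable convex function is continuously differentiable: the tangent at \<open>y\<close> lies below \<open>f\<close>,
  the tangent at \<open>x\<close> approximates \<open>f\<close> near \<open>x\<close> up to a small slope, so the gradients at \<open>x\<close> and at a
  nearby \<open>y\<close> cannot differ by more than a multiple of that slope.
\<close>

lemma continuous_on_gradient: "continuous_on S (gradient f)"
proof -
  have "isCont (gradient f) x" for x
    unfolding continuous_at_eps_delta
  proof (intro allI impI)
    fix e :: real assume "e > 0"
    have "\<exists>d>0. \<forall>y. norm (y - x) < d \<longrightarrow>
        norm (f y - f x - inner (y - x) (gradient f x)) \<le> (e/4) * norm (y - x)"
    proof -
      have "e/4 > 0" using \<open>e > 0\<close> by simp
      then show ?thesis
        using gderiv[of x] unfolding gderiv_def has_derivative_at_alt by blast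
    qed
    then obtain d where d: "d > 0"
      and lin: "\<And>y. norm (y - x) < d \<Longrightarrow>
        \<bar>f y - f x - inner (y - x) (gradient f x)\<bar> \<le> (e/4) * norm (y - x)"
      by (auto simp: real_norm_def)
    have "dist (gradient f y) (gradient f x) < e" if "dist y x < d/4" for y
    proof (cases "gradient f y = gradient f x")
      case True then show ?thesis using \<open>e > 0\<close> by simp
    next
      case False
      let ?g = "gradient f y - gradient f x"
      \<comment> \<open>probe both gradients in the direction in which they differ most; the step length keeps
        \<open>y + u\<close> inside the ball where the linear approximation at \<open>x\<close> is good\<close>
      define u where "u = (d/2 / norm ?g) *\<^sub>R ?g"
      have nu: "norm u = d/2" using False d by (simp add: u_def)
      have nyx: "norm (y - x) < d/4" using that by (simp add: dist_norm)
      have nv: "norm (y + u - x) < 3*d/4"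
        using norm_triangle_ineq[of "y - x" u] nu nyx by (simp add: algebra_simps)
      have "inner ?g u = d/2 * norm ?g"
        using False by (simp add: u_def dot_square_norm power2_eq_square)
      then have "d/2 * norm ?g = inner (gradient f y) u - inner (gradient f x) u"
        by (simp add: inner_diff_left)
      also have "\<dots> \<le> f (y + u) - f y - inner (gradient f x) u"
        using gradient_ineq[of y "y + u"] by simp
      also have "\<dots> \<le> f (y + u) - f x - inner (gradient f x) (y - x) - inner (gradient f x) u"
        using gradient_ineq[of x y] by simp
      also have "\<dots> = f (y + u) - f x - inner (y + u - x) (gradient f x)"
        by (simp add: inner_commute algebra_simps inner_simps)
      also have "\<dots> \<le> (e/4) * norm (y + u - x)"
        using lin[of "y + u"] nv d by linarith
      also have "\<dots> < (e/4) * d"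
        using nv d \<open>e > 0\<close> by simp
      finally have "norm ?g < e / 2" using d
        by (simp add: field_simps)
      then show ?thesis using \<open>e > 0\<close> by (simp add: dist_norm)
    qed
    then show "\<exists>d>0. \<forall>x'. dist x' x < d \<longrightarrow> dist (gradient f x') (gradient f x) < e"
      using d by (intro exI[of _ "d/4"]) auto
  qed
  then show ?thesis by (simp add: continuous_at_imp_continuous_on)
qed

lemma flow_solution: "hamiltonian_flow_on f {0..} (\<lambda>t. fst (flow t z)) (\<lambda>t. snd (flow t z))"
  and flow_0 [simp]: "flow 0 z = z"
proof -
  obtain X Y where "hamiltonian_flow_on f {0..} X Y" "X 0 = fst z" "Y 0 = snd z"
    using well_defined unfolding well_defined_flow_def by metis
  then have "\<exists>P. hamiltonian_flow_on f {0..} (fst \<circ> P) (snd \<circ> P) \<and> P 0 = z"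
    by (intro exI[of _ "\<lambda>t. (X t, Y t)"]) (simp add: comp_def)
  from someI_ex[OF this]
  show "hamiltonian_flow_on f {0..} (\<lambda>t. fst (flow t z)) (\<lambda>t. snd (flow t z))" "flow 0 z = z"
    unfolding hamiltonian_flow_map_def by (simp_all add: comp_def)
qed

lemma flow_unique:
  assumes "hamiltonian_flow_on f {0..} X Y" "t \<ge> 0"
  shows "(X t, Y t) = flow t (X 0, Y 0)"
proof -
  obtain X' Y' where *: "\<forall>U V. hamiltonian_flow_on f {0..} U V \<and> U 0 = X 0 \<and> V 0 = Y 0 \<longrightarrow>
      (\<forall>s\<ge>0. U s = X' s \<and> V s = Y' s)"
    using well_defined unfolding well_defined_flow_def by blast
  have "X t = X' t \<and> Y t = Y' t"
    using * assms by simp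
  moreover have "fst (flow t (X 0, Y 0)) = X' t \<and> snd (flow t (X 0, Y 0)) = Y' t"
    using *[rule_format, OF conjI[OF flow_solution[of "(X 0, Y 0)"]]] \<open>t \<ge> 0\<close> by simp
  ultimately show ?thesis by (simp add: prod_eq_iff)
qed

lemma hamiltonian_flow_on_shift:
  assumes "hamiltonian_flow_on f S X Y"
  shows "hamiltonian_flow_on f ((\<lambda>t. t - c) ` S) (\<lambda>t. X (t + c)) (\<lambda>t. Y (t + c))"
  unfolding hamiltonian_flow_on_def
proof
  fix t assume t: "t \<in> (\<lambda>t. t - c) ` S"
  have 1: "((\<lambda>t. t + c) has_vector_derivative 1) (at t within (\<lambda>t. t - c) ` S)"
    by (auto intro!: derivative_eq_intros)
  have 2: "(\<lambda>t. t + c) ` (\<lambda>t. t - c) ` S = S" by (auto simp: image_image)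
  have "t + c \<in> S" using t by auto
  then have "(X has_vector_derivative Y (t+c)) (at (t+c) within S)"
     "(Y has_vector_derivative - gradient f (X (t+c))) (at (t+c) within S)"
    using assms by (auto simp: hamiltonian_flow_on_def)
  then show "((\<lambda>t. X (t + c)) has_vector_derivative Y (t + c)) (at t within (\<lambda>t. t - c) ` S) \<and>
     ((\<lambda>t. Y (t + c)) has_vector_derivative - gradient f (X (t + c))) (at t within (\<lambda>t. t - c) ` S)"
    using vector_diff_chain_within[OF 1, of X "Y (t+c)"] vector_diff_chain_within[OF 1, of Y "- gradient f (X (t+c))"]
    by (simp add: 2 comp_def)
qed

lemma hamiltonian_flow_on_subset:
  "hamiltonian_flow_on f S X Y \<Longrightarrow> S' \<subseteq> S \<Longrightarrow> hamiltonian_flow_on f S' X Y"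
  unfolding hamiltonian_flow_on_def by (blast intro: has_vector_derivative_within_subset)

lemma flow_add:
  assumes "s \<ge> 0" "t \<ge> 0"
  shows "flow (s + t) z = flow s (flow t z)"
proof -
  have "hamiltonian_flow_on f ((\<lambda>u. u - t) ` {0..}) (\<lambda>u. fst (flow (u + t) z)) (\<lambda>u. snd (flow (u + t) z))"
    by (rule hamiltonian_flow_on_shift[OF flow_solution])
  then have "hamiltonian_flow_on f {0..} (\<lambda>u. fst (flow (u + t) z)) (\<lambda>u. snd (flow (u + t) z))"
  proof (rule hamiltonian_flow_on_subset)
    show "{0..} \<subseteq> (\<lambda>u. u - t) ` {0..}"
    proof
      fix x assume "x \<in> {0::real..}"
      then show "x \<in> (\<lambda>u. u - t) ` {0..}"
        using \<open>t \<ge> 0\<close> by (intro image_eqI[of _ _ "x + t"]) auto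
    qed
  qed
  from flow_unique[OF this \<open>s \<ge> 0\<close>] show ?thesis by simp
qed

text \<open>
  The path between two events solves the equation on a bounded interval only; this is what
  identifies it with the flow map there.
\<close>

lemma flow_unique_interval:
  assumes "hamiltonian_flow_on f {0..r} X Y" "0 \<le> t" "t \<le> r"
  shows "(X t, Y t) = flow t (X 0, Y 0)"
proof -
  let ?P = "\<lambda>t. flow (t - r) (X r, Y r)"
  have sh: "hamiltonian_flow_on f {r..} (\<lambda>t. fst (?P t)) (\<lambda>t. snd (?P t))"
  proof -
    have "(\<lambda>t. t - - r) ` {0..} = {r..}"
      by (auto simp: image_iff) (metis add.commute atLeast_iff diff_add_cancel diff_ge_0_iff_ge)
    then show ?thesis
      using hamiltonian_flow_on_shift[OF flow_solution[of "(X r, Y r)"], of "- r"] by simp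
  qed
  have clo: "closure {0..r} \<inter> closure {r..} = {r}" using assms(2,3) by auto
  have ins: "insert r {0..r} = {0..r}" "insert r {r..} = {r..}" using assms(2,3) by auto
  have X: "(X has_vector_derivative Y u) (at u within {0..r})"
          "(Y has_vector_derivative - gradient f (X u)) (at u within {0..r})" if "u \<in> {0..r}" for u
    using assms(1) that by (auto simp: hamiltonian_flow_on_def)
  have P: "((\<lambda>t. fst (?P t)) has_vector_derivative snd (?P u)) (at u within {r..})"
          "((\<lambda>t. snd (?P t)) has_vector_derivative - gradient f (fst (?P u))) (at u within {r..})" if "u \<in> {r..}" for u
    using sh that by (auto simp: hamiltonian_flow_on_def)
  \<comment> \<open>Uniqueness is available for global solutions only, so the given one is continued from time
    \<open>r\<close> on by the flow.\<close>
  define X' where "X' = (\<lambda>t. if t \<in> {0..r} then X t else fst (?P t))"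
  define Y' where "Y' = (\<lambda>t. if t \<in> {0..r} then Y t else snd (?P t))"
  have "hamiltonian_flow_on f {0..} X' Y'"
    unfolding hamiltonian_flow_on_def
  proof
    fix u :: real assume u: "u \<in> {0..}"
    have "(X' has_vector_derivative (if u \<in> {0..r} then Y u else snd (?P u))) (at u within {0..})"
      unfolding X'_def
      by (rule has_vector_derivative_If_within_closures[where T="{r..}"])
        (use u assms(2,3) X P P[of r] in \<open>auto simp: clo ins\<close>)
    moreover have "(Y' has_vector_derivative (if u \<in> {0..r} then - gradient f (X u) else - gradient f (fst (?P u)))) (at u within {0..})"
      unfolding Y'_def
      by (rule has_vector_derivative_If_within_closures[where T="{r..}"])
        (use u assms(2,3) X P P[of r] in \<open>auto simp: clo ins\<close>)
    ultimately show "(X' has_vector_derivative Y' u) (at u within {0..}) \<and>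
      (Y' has_vector_derivative - gradient f (X' u)) (at u within {0..})"
      unfolding X'_def Y'_def by (auto split: if_splits)
  qed
  from flow_unique[OF this \<open>0 \<le> t\<close>] show ?thesis
    using assms(2,3) by (simp add: X'_def Y'_def)
qed


section \<open>Conservation of energy\<close>

text \<open>
  The Hamiltonian, shifted to be nonnegative. It is conserved by the flow and does not increase when
  the velocity is reset, so along every path it stays below its initial value; this bounds
  velocities, and up to any fixed time also positions and forces, independently of the events.
\<close>

definition energy :: "'a \<times> 'a \<Rightarrow> real" where
  "energy z = f (fst z) - f xstar + (norm (snd z))\<^sup>2 / 2"

lemma flow_derivs:
  assumes "t \<ge> 0"
  shows "((\<lambda>t. fst (flow t z)) has_vector_derivative snd (flow t z)) (at t within {0..})"
    and "((\<lambda>t. snd (flow t z)) has_vector_derivative - gradient f (fst (flow t z))) (at t within {0..})"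
  using flow_solution[of z] assms by (auto simp: hamiltonian_flow_on_def)

lemma flow_f_deriv:
  assumes "t \<ge> 0"
  shows "((\<lambda>t. f (fst (flow t z))) has_real_derivative
      inner (gradient f (fst (flow t z))) (snd (flow t z))) (at t within {0..})"
proof -
  have "((\<lambda>t. fst (flow t z)) has_derivative (\<lambda>h. h *\<^sub>R snd (flow t z))) (at t within {0..})"
    using flow_derivs(1)[OF assms] by (simp add: has_vector_derivative_def)
  moreover have "(f has_derivative (\<lambda>h. inner h (gradient f (fst (flow t z))))) (at (fst (flow t z)))"
    using gderiv by (simp add: gderiv_def)
  ultimately have "((\<lambda>t. f (fst (flow t z))) has_derivative
      (\<lambda>h. inner (h *\<^sub>R snd (flow t z)) (gradient f (fst (flow t z))))) (at t within {0..})"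
    by (rule has_derivative_compose)
  then show ?thesis
    by (simp add: has_field_derivative_def inner_commute mult.commute[of _ "inner _ _"])
qed

lemma energy_flow [simp]:
  assumes "t \<ge> 0"
  shows "energy (flow t z) = energy z"
proof -
  have "((\<lambda>t. energy (flow t z)) has_field_derivative 0) (at t within {0..})" if "t \<in> {0..}" for t
  proof -
    have t: "t \<ge> 0" using that by simp
    have "((\<lambda>t. f (fst (flow t z)) - f xstar + inner (snd (flow t z)) (snd (flow t z)) / 2)
      has_real_derivative 0) (at t within {0..})"
      by (rule DERIV_cong[OF DERIV_add[OF DERIV_diff[OF flow_f_deriv[OF t] DERIV_const]
              DERIV_cdivide[OF inner_has_real_derivative[OF flow_derivs(2)[OF t] flow_derivs(2)[OF t]]]]])
        (simp add: inner_commute)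
    then show ?thesis by (simp add: energy_def dot_square_norm)
  qed
  from has_field_derivative_zero_constant[OF convex_real_interval(1) this]
  obtain c where "\<And>t. t \<in> {0..} \<Longrightarrow> energy (flow t z) = c" by blast
  from this[of t] this[of 0] assms show ?thesis by simp
qed

lemma norm_snd_le_energy: "norm (snd z) \<le> sqrt (2 * energy z)"
  using minimizer[of "fst z"] by (intro real_le_rsqrt) (simp add: energy_def)

lemma energy_nonneg: "0 \<le> energy z"
  using minimizer[of "fst z"] by (simp add: energy_def)

lemma norm_fst_flow_diff_le:
  assumes "t \<ge> 0"
  shows "norm (fst (flow t z) - fst z) \<le> t * sqrt (2 * energy z)"
proof -
  have "norm (fst (flow t z) - fst (flow 0 z)) \<le> sqrt (2 * energy z) * \<bar>t - 0\<bar>"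
    by (rule vector_derivative_lipschitz[where S="{0..}" and f'="\<lambda>t. snd (flow t z)"])
      (use assms flow_derivs(1) norm_snd_le_energy energy_flow in \<open>auto simp: \<close>, metis energy_flow norm_snd_le_energy)
  then show ?thesis using assms by (simp add: mult.commute)
qed

lemma norm_fst_flow_le:
  assumes "0 \<le> t" "t \<le> T"
  shows "norm (fst (flow t z)) \<le> norm (fst z) + T * sqrt (2 * energy z)"
proof -
  have "norm (fst (flow t z)) \<le> norm (fst z) + norm (fst (flow t z) - fst z)"
    by (metis add.commute diff_add_cancel norm_triangle_ineq)
  also have "\<dots> \<le> norm (fst z) + T * sqrt (2 * energy z)"
    using norm_fst_flow_diff_le[OF assms(1), of z] mult_right_mono[OF assms(2), of "sqrt (2 * energy z)"]
    by (simp add: energy_nonneg)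
  finally show ?thesis .
qed


section \<open>Continuous dependence on the initial state\<close>

text \<open>
  Equicontinuity of trajectories with bounded energy, for the use of Arzela-Ascoli.
\<close>

lemma flow_lipschitz:
  assumes t: "0 \<le> s" "s \<le> T" "0 \<le> t" "t \<le> T"
    and R: "norm (fst z) + T * sqrt (2 * energy z) \<le> R"
    and G: "\<And>x. norm x \<le> R \<Longrightarrow> norm (gradient f x) \<le> G"
  shows "norm (flow s z - flow t z) \<le> (sqrt (2 * energy z) + G) * \<bar>s - t\<bar>"
proof -
  have R': "norm (fst (flow u z)) \<le> R" if "0 \<le> u" "u \<le> T" for u
    using norm_fst_flow_le[OF that, of z] R by simp
  have sub: "(g has_vector_derivative g') (at u within {0..T})"
    if "(g has_vector_derivative g') (at u within {0..})" for g :: "real \<Rightarrow> 'a" and g' u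
    using that by (rule has_vector_derivative_within_subset) auto
  have 1: "norm (fst (flow s z) - fst (flow t z)) \<le> sqrt (2 * energy z) * \<bar>s - t\<bar>"
    by (rule vector_derivative_lipschitz[where S="{0..T}" and f'="\<lambda>t. snd (flow t z)"])
      (use t in \<open>auto intro!: sub flow_derivs(1)\<close>, metis energy_flow norm_snd_le_energy)
  have 2: "norm (snd (flow s z) - snd (flow t z)) \<le> G * \<bar>s - t\<bar>"
    by (rule vector_derivative_lipschitz[where S="{0..T}" and f'="\<lambda>t. - gradient f (fst (flow t z))"])
      (use t in \<open>auto intro!: sub flow_derivs(2) G R'\<close>)
  show ?thesis
    using norm_Pair_le[of "fst (flow s z) - fst (flow t z)" "snd (flow s z) - snd (flow t z)"] 1 2
    by (simp add: minus_prod_def distrib_right)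
qed

lemma gradient_bounded_on_ball:
  obtains G where "G \<ge> 0" "\<And>x. norm x \<le> R \<Longrightarrow> norm (gradient f x) \<le> G"
proof -
  have "compact (gradient f ` cball 0 R)"
    by (intro compact_continuous_image continuous_on_gradient compact_cball)
  then obtain G where "G > 0" "\<forall>y\<in>gradient f ` cball 0 R. norm y \<le> G"
    using compact_imp_bounded bounded_pos by metis
  then show ?thesis by (intro that[of G]) auto
qed

text \<open>
  The gradient is not assumed Lipschitz, so continuous dependence cannot come from Gronwall's
  inequality. Instead, trajectories starting near \<open>z\<close> are equicontinuous, a subsequence converges
  uniformly, its limit solves the equation from \<open>z\<close>, and uniqueness identifies it.
\<close>

lemma flow_tendsto_subsequence:
  assumes z: "zs \<longlonglongrightarrow> z" and t: "ts \<longlonglongrightarrow> t" and ts0: "\<And>n. 0 \<le> ts n"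
  obtains k where "strict_mono (k :: nat \<Rightarrow> nat)"
    "(\<lambda>n. flow (ts (k n)) (zs (k n))) \<longlonglongrightarrow> flow t z"
proof -
  obtain T where T: "T > 0" "\<And>n. ts n \<le> T"
    using tendsto_imp_bounded_above[OF t] by blast
  have t0: "0 \<le> t" "t \<le> T"
    using LIMSEQ_le_const[OF t] LIMSEQ_le_const2[OF t] ts0 T by auto
  have "(\<lambda>n. energy (zs n)) \<longlonglongrightarrow> energy z"
    unfolding energy_def
    by (intro tendsto_intros continuous_on_tendsto_compose[OF continuous_on_f[of UNIV]] z) auto
  then obtain E where E: "\<And>n. energy (zs n) \<le> E"
    using tendsto_imp_bounded_above by blast
  obtain C where C: "\<And>n. norm (zs n) \<le> C"
    using tendsto_imp_norm_bounded[OF z] by blast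
  define R where "R = C + T * sqrt (2 * E)"
  have R: "norm (fst (zs n)) + T * sqrt (2 * energy (zs n)) \<le> R" for n
    unfolding R_def using C[of n] E[of n] T(1) norm_fst_le[of "fst (zs n)" "snd (zs n)"]
    by (intro add_mono mult_left_mono real_sqrt_le_mono) auto
  have R': "norm (fst (flow s (zs n))) \<le> R" if "0 \<le> s" "s \<le> T" for s n
    using norm_fst_flow_le[OF that, of "zs n"] R[of n] by simp
  obtain G where G: "G \<ge> 0" "\<And>x. norm x \<le> R \<Longrightarrow> norm (gradient f x) \<le> G"
    using gradient_bounded_on_ball by blast
  define B where "B = sqrt (2 * E) + G + 1"
  have "0 \<le> E" using E[of 0] energy_nonneg[of "zs 0"] by simp
  then have B: "B > 0" using G(1) unfolding B_def by (simp add: add_nonneg_pos)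
  have lip: "norm (flow s (zs n) - flow s' (zs n)) \<le> B * \<bar>s - s'\<bar>"
    if "s \<in> {0..T}" "s' \<in> {0..T}" for s s' n
  proof -
    have "norm (flow s (zs n) - flow s' (zs n)) \<le> (sqrt (2 * energy (zs n)) + G) * \<bar>s - s'\<bar>"
      using that by (intro flow_lipschitz[OF _ _ _ _ R[of n] G(2)]) auto
    also have "\<dots> \<le> B * \<bar>s - s'\<bar>"
    proof (rule mult_right_mono)
      have "sqrt (2 * energy (zs n)) \<le> sqrt (2 * E)"
        using E[of n] by simp
      then show "sqrt (2 * energy (zs n)) + G \<le> B" unfolding B_def by linarith
    qed simp
    finally show ?thesis .
  qed
  have bdd: "norm (flow s (zs n)) \<le> C + B * T" if "s \<in> {0..T}" for s n
  proof -
    have "norm (flow s (zs n)) \<le> norm (flow s (zs n) - flow 0 (zs n)) + norm (zs n)"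
      using norm_triangle_sub[of "flow s (zs n)" "zs n"] by simp
    moreover have "norm (flow s (zs n) - flow 0 (zs n)) \<le> B * s" using lip[of s 0 n] that T(1) by simp
    moreover have "B * s \<le> B * T" using that B by simp
    ultimately show ?thesis using C[of n] by simp
  qed
  have equi: "\<exists>d>0. \<forall>n s'. s' \<in> {0..T} \<and> norm (s - s') < d \<longrightarrow> norm (flow s (zs n) - flow s' (zs n)) < e"
    if s: "s \<in> {0..T}" and e: "0 < e" for s e
  proof (intro exI conjI allI impI)
    show "0 < e / B" using e B by simp
    fix n s' assume a: "s' \<in> {0..T} \<and> norm (s - s') < e / B"
    have "norm (flow s (zs n) - flow s' (zs n)) \<le> B * \<bar>s - s'\<bar>" using lip s a by blast
    also have "\<dots> < e" using a B by (simp add: pos_less_divide_eq mult.commute)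
    finally show "norm (flow s (zs n) - flow s' (zs n)) < e" .
  qed
  have "\<exists>g k. continuous_on {0..T} g \<and> strict_mono (k :: nat \<Rightarrow> nat) \<and>
    (\<forall>e>0. \<exists>N. \<forall>n x. n \<ge> N \<and> x \<in> {0..T} \<longrightarrow> norm (flow x (zs (k n)) - g x) < e)"
  proof (rule Arzela_Ascoli[of "{0..T}" "\<lambda>n s. flow s (zs n)" "C + B * T"])
    fix g and k :: "nat \<Rightarrow> nat"
    assume "continuous_on {0..T} g" "strict_mono k"
      "\<And>e. 0 < e \<Longrightarrow> \<exists>N. \<forall>n x. n \<ge> N \<and> x \<in> {0..T} \<longrightarrow> norm (flow x (zs (k n)) - g x) < e"
    then show ?thesis by blast
  qed (use bdd equi in auto)
  then obtain g k where g: "strict_mono (k :: nat \<Rightarrow> nat)"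
    "\<And>e. 0 < e \<Longrightarrow> \<exists>N. \<forall>n x. n \<ge> N \<and> x \<in> {0..T} \<longrightarrow> norm (flow x (zs (k n)) - g x) < e"
    by blast
  have ul: "uniform_limit {0..T} (\<lambda>n s. flow s (zs (k n))) g sequentially"
  proof (rule uniform_limitI)
    fix e :: real assume "e > 0"
    from g(2)[OF this] obtain N
      where "\<And>n x. n \<ge> N \<Longrightarrow> x \<in> {0..T} \<Longrightarrow> norm (flow x (zs (k n)) - g x) < e"
      by blast
    then show "\<forall>\<^sub>F n in sequentially. \<forall>s\<in>{0..T}. dist (flow s (zs (k n))) (g s) < e"
      unfolding eventually_sequentially dist_norm by blast
  qed
  have ulf: "uniform_limit {0..T} (\<lambda>n s. fst (flow s (zs (k n)))) (\<lambda>s. fst (g s)) sequentially"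
    and uls: "uniform_limit {0..T} (\<lambda>n s. snd (flow s (zs (k n)))) (\<lambda>s. snd (g s)) sequentially"
    using bounded_linear.uniform_limit[OF bounded_linear_fst ul]
      bounded_linear.uniform_limit[OF bounded_linear_snd ul] by auto
  have "uniformly_continuous_on (cball 0 R) (gradient f)"
    by (intro compact_uniformly_continuous continuous_on_gradient compact_cball)
  then have "uniform_limit {0..T} (\<lambda>n s. gradient f (fst (flow s (zs (k n))))) (\<lambda>s. gradient f (fst (g s))) sequentially"
    by (rule uniform_limit_compose_uniformly_continuous_on[OF ulf]) (auto simp: R')
  then have ulg: "uniform_limit {0..T} (\<lambda>n s. - gradient f (fst (flow s (zs (k n))))) (\<lambda>s. - gradient f (fst (g s))) sequentially"
    by (rule uniform_limit_intros)
  have sub: "(h has_vector_derivative h') (at u within {0..T})"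
    if "(h has_vector_derivative h') (at u within {0..})" for h :: "real \<Rightarrow> 'a" and h' u
    using that by (rule has_vector_derivative_within_subset) auto
  \<comment> \<open>the uniform limit of the trajectories is again a trajectory, hence the one of \<open>z\<close>\<close>
  have "hamiltonian_flow_on f {0..T} (\<lambda>s. fst (g s)) (\<lambda>s. snd (g s))"
    unfolding hamiltonian_flow_on_def
  proof (intro ballI conjI)
    fix s assume s: "s \<in> {0..T}"
    show "((\<lambda>s. fst (g s)) has_vector_derivative snd (g s)) (at s within {0..T})"
      by (rule has_vector_derivative_uniform_limit[OF _ _ _ uls s])
        (use tendsto_uniform_limitI[OF ulf] in \<open>auto intro!: sub flow_derivs(1)\<close>)
    show "((\<lambda>s. snd (g s)) has_vector_derivative - gradient f (fst (g s))) (at s within {0..T})"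
      by (rule has_vector_derivative_uniform_limit[OF _ _ _ ulg s])
        (use tendsto_uniform_limitI[OF uls] in \<open>auto intro!: sub flow_derivs(2)\<close>)
  qed
  from flow_unique_interval[OF this t0]
  have gt: "g t = flow t (g 0)" by simp
  have "(\<lambda>n. zs (k n)) \<longlonglongrightarrow> z"
    using LIMSEQ_subseq_LIMSEQ[OF z g(1)] by (simp add: comp_def)
  moreover have "(\<lambda>n. zs (k n)) \<longlonglongrightarrow> g 0"
    using tendsto_uniform_limitI[OF ul, of 0] T(1) by simp
  ultimately have g0: "g 0 = z" by (rule LIMSEQ_unique[symmetric])
  have tk: "(\<lambda>n. ts (k n)) \<longlonglongrightarrow> t"
    using LIMSEQ_subseq_LIMSEQ[OF t g(1)] by (simp add: comp_def)
  have "(\<lambda>n. norm (flow (ts (k n)) (zs (k n)) - flow t (zs (k n)))) \<longlonglongrightarrow> 0"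
  proof (rule Lim_null_comparison)
    show "\<forall>\<^sub>F n in sequentially. norm (norm (flow (ts (k n)) (zs (k n)) - flow t (zs (k n)))) \<le> B * \<bar>ts (k n) - t\<bar>"
      using lip ts0 T t0 by (intro always_eventually allI) simp
    show "(\<lambda>n. B * \<bar>ts (k n) - t\<bar>) \<longlonglongrightarrow> 0"
      using tk by (auto intro!: tendsto_eq_intros)
  qed
  then have "(\<lambda>n. flow (ts (k n)) (zs (k n)) - flow t (zs (k n))) \<longlonglongrightarrow> 0"
    by (rule tendsto_norm_zero_cancel)
  moreover have "(\<lambda>n. flow t (zs (k n))) \<longlonglongrightarrow> flow t z"
    using tendsto_uniform_limitI[OF ul, of t] t0 gt g0 by simp
  ultimately have "(\<lambda>n. flow (ts (k n)) (zs (k n))) \<longlonglongrightarrow> flow t z"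
    using tendsto_add by fastforce
  with g(1) show ?thesis by (rule that)
qed

text \<open>
  Joint continuity of the flow map in time and initial state: a sequence staying away from the limit
  would have no subsequence as in the previous lemma.
\<close>

lemma flow_tendsto:
  assumes z: "zs \<longlonglongrightarrow> z" and t: "ts \<longlonglongrightarrow> t" and ts0: "\<And>n. 0 \<le> ts n"
  shows "(\<lambda>n. flow (ts n) (zs n)) \<longlonglongrightarrow> flow t z"
proof (rule ccontr)
  assume "\<not> ?thesis"
  then obtain e r where e: "e > 0" and r: "strict_mono (r :: nat \<Rightarrow> nat)"
    and far: "\<And>n. e \<le> dist (flow (ts (r n)) (zs (r n))) (flow t z)"
    by (rule not_tendsto_subsequence) blast
  obtain k where k: "(\<lambda>n. flow (ts (r (k n))) (zs (r (k n)))) \<longlonglongrightarrow> flow t z"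
    using flow_tendsto_subsequence[of "zs \<circ> r" z "ts \<circ> r" t]
      LIMSEQ_subseq_LIMSEQ[OF z r] LIMSEQ_subseq_LIMSEQ[OF t r] ts0 by auto
  from tendstoD[OF k e] obtain n where "dist (flow (ts (r (k n))) (zs (r (k n)))) (flow t z) < e"
    by (auto simp: eventually_sequentially)
  with far[of "k n"] show False by simp
qed


section \<open>The Lyapunov function\<close>

definition refresh :: "'a \<times> 'a \<Rightarrow> 'a \<times> 'a" where
  "refresh z = (fst z, 0)"

text \<open>
  Here \<open>s\<close> stands for \<open>t + 1\<close>. The cross term and the weight \<open>5\<close> of the squared distance are tuned to the
  rate \<open>6 / s\<close>: in expected motion all terms in the velocity cancel.
\<close>

definition lyapunov :: "real \<Rightarrow> 'a \<times> 'a \<Rightarrow> real" where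
  "lyapunov s z = s\<^sup>2 * (f (fst z) - f xstar) + s\<^sup>2 / 2 * inner (snd z) (snd z)
     + 2 * s * inner (snd z) (fst z - xstar) + 5 * inner (fst z - xstar) (fst z - xstar)"

text \<open>
  An upper bound, from convexity, for the time derivative of \<^const>\<open>lyapunov\<close> along the flow.
\<close>

definition drift :: "real \<Rightarrow> 'a \<times> 'a \<Rightarrow> real" where
  "drift s z = 3 * s * inner (snd z) (snd z) + 12 * inner (snd z) (fst z - xstar)"

text \<open>
  A reset removes exactly \<open>s / 6\<close> times the drift. Since resets occur at rate \<open>6 / s\<close>, they compensate the
  drift on average; the rate is chosen for this identity.
\<close>

lemma lyapunov_refresh: "lyapunov s (refresh z) = lyapunov s z - s / 6 * drift s z"
  by (simp add: lyapunov_def refresh_def drift_def power2_eq_square algebra_simps)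

text \<open>
  Completing the square in velocity and distance leaves the function gap.
\<close>

lemma lyapunov_ge: "s\<^sup>2 * (f (fst z) - f xstar) \<le> lyapunov s z"
proof -
  have square: "inner (s *\<^sub>R y + 2 *\<^sub>R w) (s *\<^sub>R y + 2 *\<^sub>R w) / 2 + 3 * inner w w
      = s\<^sup>2 / 2 * inner y y + 2 * s * inner y w + 5 * inner w w" for y w :: 'a
    by (simp add: inner_add_left inner_add_right inner_commute[of w y] power2_eq_square field_simps)
  have "0 \<le> inner (s *\<^sub>R y + 2 *\<^sub>R w) (s *\<^sub>R y + 2 *\<^sub>R w) / 2 + 3 * inner w w" for y w :: 'a
    by (intro add_nonneg_nonneg mult_nonneg_nonneg divide_nonneg_nonneg inner_ge_zero) simp_all
  from this[of "snd z" "fst z - xstar"] show ?thesis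
    unfolding square lyapunov_def by linarith
qed

text \<open>
  Without a reset, the Lyapunov function increases over a short time \<open>h\<close> by at most \<open>h\<close> times the drift,
  up to second order in \<open>h\<close>.
  The drift is taken at the end of the step because this is where the chain below is reset.
\<close>

lemma lyapunov_step:
  fixes E D G S :: real
  defines "V \<equiv> sqrt (2 * E)"
  assumes h: "0 \<le> h" and s: "0 \<le> s" "s + h \<le> S"
    and E: "energy z \<le> E" and D: "norm (fst z - xstar) + h * V \<le> D"
    and G: "\<And>x. norm (x - xstar) \<le> D \<Longrightarrow> norm (gradient f x) \<le> G"
  shows "lyapunov (s + h) (flow h z)
    \<le> lyapunov s z + h * drift (s + h) (flow h z) + (15 * V\<^sup>2 + 6 * S * (V * G) + 12 * (G * D)) * h\<^sup>2"
proof -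
  define C where "C = 15 * V\<^sup>2 + 6 * S * (V * G) + 12 * (G * D)"
  define X where "X = (\<lambda>r. fst (flow r z))"
  define Y where "Y = (\<lambda>r. snd (flow r z))"
  have Y_le: "norm (Y r) \<le> V" if "r \<in> {0..h}" for r
  proof -
    have "norm (Y r) \<le> sqrt (2 * energy z)"
      using norm_snd_le_energy[of "flow r z"] that by (simp add: Y_def)
    also have "\<dots> \<le> V" using E by (simp add: V_def)
    finally show ?thesis .
  qed
  have X_le: "norm (X r - xstar) \<le> D" if r: "r \<in> {0..h}" for r
  proof -
    have "norm (X r - xstar) \<le> norm (X r - fst z) + norm (fst z - xstar)"
      using dist_triangle[of "X r" xstar "fst z"] by (simp add: dist_norm)
    also have "norm (X r - fst z) \<le> r * sqrt (2 * energy z)"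
      using norm_fst_flow_diff_le[of r z] r by (simp add: X_def)
    also have "r * sqrt (2 * energy z) \<le> h * V"
      unfolding V_def using r E energy_nonneg[of z] by (intro mult_mono) auto
    finally show ?thesis using D by simp
  qed
  have V0: "V \<ge> 0" using order_trans[OF norm_ge_zero Y_le[of 0]] h by simp
  have D0: "D \<ge> 0" using order_trans[OF norm_ge_zero X_le[of 0]] h by simp
  have G_le: "norm (gradient f (X r)) \<le> G" if "r \<in> {0..h}" for r
    using G X_le[OF that] by simp
  have G0: "G \<ge> 0" using order_trans[OF norm_ge_zero G_le[of 0]] h by simp
  have sub: "(g has_field_derivative g') (at u within {0..h})"
    if "(g has_field_derivative g') (at u within {0..})" for g :: "real \<Rightarrow> real" and g' u
    using that by (rule DERIV_subset) auto
  have dX: "(X has_vector_derivative Y r) (at r within {0..})"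
    and dXs: "((\<lambda>r. X r - xstar) has_vector_derivative Y r) (at r within {0..})"
    and dY: "(Y has_vector_derivative - gradient f (X r)) (at r within {0..})"
    and df: "((\<lambda>r. f (X r)) has_real_derivative inner (gradient f (X r)) (Y r)) (at r within {0..})"
    if "r \<ge> 0" for r
    using flow_derivs[OF that, of z] flow_f_deriv[OF that, of z]
    by (auto simp: X_def Y_def has_vector_derivative_diff_const)
  have ds: "((\<lambda>r. s + r) has_real_derivative 1) (at r within {0..})" for r
    by (auto intro!: derivative_eq_intros)
  have dYY: "((\<lambda>r. inner (Y r) (Y r)) has_real_derivative 2 * inner (Y r) (- gradient f (X r))) (at r within {0..})"
    and dYX: "((\<lambda>r. inner (Y r) (X r - xstar)) has_real_derivative
        inner (Y r) (Y r) + inner (- gradient f (X r)) (X r - xstar)) (at r within {0..})"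
    and dXX: "((\<lambda>r. inner (X r - xstar) (X r - xstar)) has_real_derivative 2 * inner (Y r) (X r - xstar)) (at r within {0..})"
    if r: "r \<ge> 0" for r
    using inner_has_real_derivative[OF dY[OF r] dY[OF r]] inner_has_real_derivative[OF dY[OF r] dXs[OF r]]
      inner_has_real_derivative[OF dXs[OF r] dXs[OF r]]
    by (simp_all add: inner_commute)
  \<comment> \<open>Positions, velocities and forces stay bounded, so the drift is Lipschitz along the flow and
    may be evaluated at the end of the step at the price of an error of order \<open>h\<^sup>2\<close>.\<close>
  define K where "K = (\<lambda>r. drift (s + r) (flow r z))"
  define K' where "K' = (\<lambda>r. 3 * inner (Y r) (Y r) + 6 * (s + r) * inner (Y r) (- gradient f (X r))
      + 12 * (inner (Y r) (Y r) + inner (- gradient f (X r)) (X r - xstar)))"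
  have dK: "(K has_real_derivative K' r) (at r within {0..})" if r: "r \<ge> 0" for r
  proof -
    have eq: "K = (\<lambda>r. 3 * ((s + r) * inner (Y r) (Y r)) + 12 * inner (Y r) (X r - xstar))"
      by (simp add: K_def drift_def X_def Y_def algebra_simps)
    show ?thesis
      unfolding eq by (intro DERIV_cong[OF DERIV_add[OF DERIV_cmult[OF DERIV_mult[OF ds dYY[OF r]]] DERIV_cmult[OF dYX[OF r]]]])
        (simp add: K'_def algebra_simps)
  qed
  have K'_le: "norm (K' r) \<le> C" if r: "r \<in> {0..h}" for r
  proof -
    have cs: "\<bar>inner u v\<bar> \<le> a * b" if "norm u \<le> a" "norm v \<le> b" for u v :: 'a and a b
      using Cauchy_Schwarz_ineq2[of u v] mult_mono[OF that] norm_ge_zero[of u] norm_ge_zero[of v] that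
      by linarith
    have 1: "\<bar>inner (Y r) (Y r)\<bar> \<le> V * V" by (intro cs Y_le r)
    have 2: "\<bar>inner (Y r) (- gradient f (X r))\<bar> \<le> V * G"
      by (rule cs) (use Y_le[OF r] G_le[OF r] in auto)
    have 3: "\<bar>inner (- gradient f (X r)) (X r - xstar)\<bar> \<le> G * D"
      by (rule cs) (use X_le[OF r] G_le[OF r] in auto)
    have 4: "\<bar>(s + r) * inner (Y r) (- gradient f (X r))\<bar> \<le> S * (V * G)"
      unfolding abs_mult by (rule mult_mono) (use 2 s r in auto)
    have "K' r = 15 * inner (Y r) (Y r) + 6 * ((s + r) * inner (Y r) (- gradient f (X r)))
        + 12 * inner (- gradient f (X r)) (X r - xstar)"
      by (simp add: K'_def algebra_simps)
    moreover have "C = 15 * (V * V) + 6 * (S * (V * G)) + 12 * (G * D)"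
      by (simp add: C_def power2_eq_square)
    ultimately show ?thesis
      using 1 3 4 unfolding real_norm_def by linarith
  qed
  have K_lip: "\<bar>K r - K h\<bar> \<le> C * h" if r: "r \<in> {0..h}" for r
  proof -
    have "norm (K r - K h) \<le> C * \<bar>r - h\<bar>"
    proof (rule vector_derivative_lipschitz[where S="{0..h}" and f'=K'])
      show "(K has_vector_derivative K' u) (at u within {0..h})" if "u \<in> {0..h}" for u
        using sub[OF dK[of u]] that
        by (simp add: has_real_derivative_iff_has_vector_derivative[symmetric])
    qed (use r h K'_le in auto)
    also have "\<dots> \<le> C * h"
      using r K'_le[OF r] norm_ge_zero[of "K' r"] by (intro mult_left_mono) auto
    finally show ?thesis by simp
  qed
  define L where "L = (\<lambda>r. lyapunov (s + r) (flow r z))"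
  define L' where "L' = (\<lambda>r. 2 * (s + r) * (f (X r) - f xstar) + (s + r) * inner (Y r) (Y r)
     + 2 * inner (Y r) (X r - xstar) + 2 * (s + r) * (inner (Y r) (Y r) + inner (- gradient f (X r)) (X r - xstar))
     + 10 * inner (Y r) (X r - xstar))"
  have dL: "(L has_real_derivative L' r) (at r within {0..})" if r: "r \<ge> 0" for r
  proof -
    have eq: "L = (\<lambda>r. (s + r) * ((s + r) * (f (X r) - f xstar)) + 1/2 * ((s + r) * ((s + r) * inner (Y r) (Y r)))
       + 2 * ((s + r) * inner (Y r) (X r - xstar)) + 5 * inner (X r - xstar) (X r - xstar))"
      by (simp add: L_def lyapunov_def X_def Y_def power2_eq_square algebra_simps add_divide_distrib)
    show ?thesis
      unfolding eq by (intro DERIV_cong[OF DERIV_add[OF DERIV_add[OF DERIV_add[OF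
          DERIV_mult[OF ds DERIV_mult[OF ds DERIV_diff[OF df[OF r] DERIV_const]]]
          DERIV_cmult[OF DERIV_mult[OF ds DERIV_mult[OF ds dYY[OF r]]]]]
          DERIV_cmult[OF DERIV_mult[OF ds dYX[OF r]]]]
          DERIV_cmult[OF dXX[OF r]]]])
        (simp add: L'_def algebra_simps inner_commute)
  qed
  \<comment> \<open>The terms in the potential and in the force combine to
    \<open>2 (s + r) (f x - f x* - \<langle>\<nabla>f x, x - x*\<rangle>)\<close>, which convexity makes nonpositive.\<close>
  have L'_le: "L' r \<le> K r" if r: "r \<in> {0..h}" for r
  proof -
    have "f (X r) - f xstar + inner (- gradient f (X r)) (X r - xstar) \<le> 0"
      using gradient_ineq[of "X r" xstar] by (simp add: inner_diff_right)
    then have "2 * (s + r) * (f (X r) - f xstar + inner (- gradient f (X r)) (X r - xstar)) \<le> 0"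
      using s r by (intro mult_nonneg_nonpos) auto
    then show ?thesis
      by (simp add: L'_def K_def drift_def X_def Y_def algebra_simps)
  qed
  have "(L has_derivative (\<lambda>d. d * L' u)) (at u within {0..h})" if "0 \<le> u" "u \<le> h" for u
    using sub[OF dL[OF that(1)]] by (simp add: has_field_derivative_def mult_commute_abs)
  from mvt_very_simple[OF h this]
  have "\<exists>r\<in>{0..h}. L h - L 0 = (h - 0) * L' r" .
  then obtain r where r: "r \<in> {0..h}" "L h - L 0 = h * L' r" by auto
  have "h * L' r \<le> h * (K h + C * h)"
    using L'_le[OF r(1)] K_lip[OF r(1)] h by (intro mult_left_mono) auto
  then show ?thesis
    using r(2) by (simp add: L_def K_def C_def power2_eq_square algebra_simps)
qed


section \<open>Resets on a grid\<close>

text \<open>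
  The process on a grid of width \<open>h\<close>: \<open>c i\<close> is the number of events in the \<open>i\<close>-th cell, and the velocity is
  reset at the end of a cell with at least one event.
\<close>

primrec grid_chain :: "real \<Rightarrow> (nat \<Rightarrow> nat) \<Rightarrow> 'a \<times> 'a \<Rightarrow> nat \<Rightarrow> 'a \<times> 'a" where
  "grid_chain h c z 0 = z"
| "grid_chain h c z (Suc i) =
     (if c i = 0 then flow h (grid_chain h c z i) else refresh (flow h (grid_chain h c z i)))"

lemma energy_refresh_le: "energy (refresh z) \<le> energy z"
  by (simp add: energy_def refresh_def)

lemma grid_chain_bounds:
  assumes "h \<ge> 0"
  shows energy_grid_chain_le: "energy (grid_chain h c z i) \<le> energy z"
    and norm_grid_chain_diff_le:
      "norm (fst (grid_chain h c z i) - fst z) \<le> i * h * sqrt (2 * energy z)"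
proof (induction i)
  case (Suc i)
  let ?w = "grid_chain h c z i"
  show "energy (grid_chain h c z (Suc i)) \<le> energy z"
    using Suc(1) energy_refresh_le[of "flow h ?w"] assms by auto
  have "norm (fst (flow h ?w) - fst z) \<le> norm (fst (flow h ?w) - fst ?w) + norm (fst ?w - fst z)"
    using dist_triangle[of "fst (flow h ?w)" "fst z" "fst ?w"] by (simp add: dist_norm)
  also have "norm (fst (flow h ?w) - fst ?w) \<le> h * sqrt (2 * energy ?w)"
    by (rule norm_fst_flow_diff_le[OF assms])
  also have "h * sqrt (2 * energy ?w) \<le> h * sqrt (2 * energy z)"
    using assms Suc(1) by (intro mult_left_mono) auto
  finally show "norm (fst (grid_chain h c z (Suc i)) - fst z) \<le> Suc i * h * sqrt (2 * energy z)"
    using Suc(2) by (auto simp: refresh_def algebra_simps)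
qed auto

text \<open>
  The position at the \<open>k\<close>-th reset if resets happen at the times \<open>\<theta> 1, \<theta> 2, \<dots>\<close> and the path starts at rest
  at time \<open>\<theta> 0\<close>. Coinciding times are harmless, because the flow over duration zero is the identity.
\<close>

primrec reset_position :: "(nat \<Rightarrow> real) \<Rightarrow> 'a \<Rightarrow> nat \<Rightarrow> 'a" where
  "reset_position \<theta> x 0 = x"
| "reset_position \<theta> x (Suc k) = fst (flow (\<theta> (Suc k) - \<theta> k) (reset_position \<theta> x k, 0))"

lemma hamiltonian_flow_on_eq_flow:
  assumes "hamiltonian_flow_on f {a..<b} X Y" "a \<le> t" "t < b"
  shows "(X t, Y t) = flow (t - a) (X a, Y a)"
proof -
  have "hamiltonian_flow_on f ((\<lambda>u. u - a) ` {a..t}) (\<lambda>u. X (u + a)) (\<lambda>u. Y (u + a))"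
    by (rule hamiltonian_flow_on_shift, rule hamiltonian_flow_on_subset[OF assms(1)]) (use assms in auto)
  then have "hamiltonian_flow_on f {0..t - a} (\<lambda>u. X (u + a)) (\<lambda>u. Y (u + a))"
    by simp
  from flow_unique_interval[OF this, of "t - a"] show ?thesis using assms by simp
qed

text \<open>
  The velocity may jump at \<open>b\<close>, so only the position is determined there, as a limit from the left.
\<close>

lemma hamiltonian_flow_on_endpoint:
  assumes flow: "hamiltonian_flow_on f {a..<b} X Y" and X: "continuous_on {a..b} X" and ab: "a \<le> b"
  shows "X b = fst (flow (b - a) (X a, Y a))"
proof (cases "a = b")
  case False
  with ab have ab: "a < b" by simp
  let ?g = "\<lambda>t. fst (flow (t - a) (X a, Y a))"
  have "continuous_on {0..} (\<lambda>t. fst (flow t (X a, Y a)))"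
    by (rule continuous_on_vector_derivative[OF flow_derivs(1)]) simp
  then have "continuous_on {a..b} ?g"
    by (rule continuous_on_compose2) (auto intro!: continuous_intros)
  with X have "continuous_on {a..b} (\<lambda>t. X t - ?g t)" by (intro continuous_on_diff)
  then have cl: "closed {t \<in> {a..b}. X t - ?g t = 0}"
    by (rule continuous_closed_preimage_constant) simp
  have "{a..<b} \<subseteq> {t \<in> {a..b}. X t - ?g t = 0}"
  proof
    fix t assume t: "t \<in> {a..<b}"
    then have "(X t, Y t) = flow (t - a) (X a, Y a)"
      by (intro hamiltonian_flow_on_eq_flow[OF flow]) auto
    then show "t \<in> {t \<in> {a..b}. X t - ?g t = 0}" using t by (simp add: prod_eq_iff)
  qed
  then have "closure {a..<b} \<subseteq> {t \<in> {a..b}. X t - ?g t = 0}"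
    using cl by (rule closure_minimal)
  moreover have "b \<in> closure {a..<b}" using ab by simp
  ultimately show ?thesis by auto
qed simp

lemma randomized_hamiltonian_path_eq_flow:
  fixes \<tau> :: "nat \<Rightarrow> real"
  assumes path: "randomized_hamiltonian_path f \<tau> X Y" and X0: "X 0 = x" and Y0: "Y 0 = 0"
    and \<tau>: "0 \<le> \<tau> 0" "strict_mono \<tau>"
  defines "\<theta> \<equiv> case_nat 0 \<tau>"
  shows reset_position_eq: "X (\<theta> k) = reset_position \<theta> x k"
    and "\<lbrakk>\<theta> k \<le> t; t < \<theta> (Suc k)\<rbrakk> \<Longrightarrow> (X t, Y t) = flow (t - \<theta> k) (reset_position \<theta> x k, 0)"
proof -
  have fl: "hamiltonian_flow_on f {\<theta> k..<\<theta> (Suc k)} X Y" for k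
    using path by (cases k) (auto simp: randomized_hamiltonian_path_def \<theta>_def)
  have Y: "Y (\<theta> k) = 0" for k
    using path Y0 by (cases k) (auto simp: randomized_hamiltonian_path_def \<theta>_def)
  have \<theta>_le: "\<theta> k \<le> \<theta> (Suc k)" for k
    using \<tau> by (cases k) (auto simp: \<theta>_def strict_mono_less_eq)
  have \<theta>0: "0 \<le> \<theta> k" for k
    using \<theta>_le by (induction k) (auto simp: \<theta>_def intro: order_trans)
  have X: "continuous_on {\<theta> k..\<theta> (Suc k)} X" for k
    using path \<theta>0[of k] continuous_on_subset[of "{0..}" X] by (auto simp: randomized_hamiltonian_path_def)
  show 1: "X (\<theta> k) = reset_position \<theta> x k" for k
  proof (induction k)
    case (Suc k)
    then show ?case
      using hamiltonian_flow_on_endpoint[OF fl X \<theta>_le, of k] Y[of k] by simp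
  qed (simp add: X0 \<theta>_def)
  show "(X t, Y t) = flow (t - \<theta> k) (reset_position \<theta> x k, 0)" if "\<theta> k \<le> t" "t < \<theta> (Suc k)"
    using hamiltonian_flow_on_eq_flow[OF fl that] 1[of k] Y[of k] by simp
qed

end

text \<open>
  The index of the first event after time \<open>t\<close> is the number of events up to \<open>t\<close>.
\<close>

lemma le_event_time_iff_less_Least:
  fixes \<tau> :: "nat \<Rightarrow> real"
  assumes "strict_mono \<tau>" "filterlim \<tau> at_top sequentially"
  shows "\<tau> k \<le> t \<longleftrightarrow> k < (LEAST k. t < \<tau> k)"
proof -
  have "\<exists>k. t < \<tau> k"
    using assms(2) unfolding filterlim_at_top_dense by (metis eventually_sequentially order_refl)
  then have L: "t < \<tau> (LEAST k. t < \<tau> k)" by (rule LeastI_ex)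
  show ?thesis
  proof
    assume "\<tau> k \<le> t"
    with L have "\<tau> k < \<tau> (LEAST k. t < \<tau> k)" by simp
    then show "k < (LEAST k. t < \<tau> k)" using assms(1) by (simp add: strict_mono_less)
  next
    assume "k < (LEAST k. t < \<tau> k)"
    from not_less_Least[OF this] show "\<tau> k \<le> t" by simp
  qed
qed

context convex_hamiltonian_system
begin

text \<open>
  The chain is the true path for events moved to the right ends of their cells, that is for the
  event times \<open>\<sigma>\<close>. This reduces the comparison with the true path to continuity in the event times.
\<close>

lemma grid_chain_eq_flow:
  fixes \<tau> :: "nat \<Rightarrow> real"
  assumes h: "h > 0" and \<tau>: "0 \<le> \<tau> 0" "strict_mono \<tau>" "filterlim \<tau> at_top sequentially"
  defines "\<sigma> \<equiv> case_nat 0 (\<lambda>k. h * of_int \<lceil>\<tau> k / h\<rceil>)"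
    and "N \<equiv> \<lambda>t. LEAST k. t < \<tau> k"
    and "c \<equiv> \<lambda>i. card {k. \<tau> k \<in> {real i * h<..real (Suc i) * h}}"
  shows "\<sigma> (N (i * h)) \<le> i * h \<and>
    grid_chain h c (x, 0) i = flow (i * h - \<sigma> (N (i * h))) (reset_position \<sigma> x (N (i * h)), 0)"
proof -
  have N: "\<tau> k \<le> t \<longleftrightarrow> k < N t" for k t
    unfolding N_def by (rule le_event_time_iff_less_Least[OF \<tau>(2,3)])
  have \<tau>0: "0 \<le> \<tau> k" for k
    using \<tau>(1) strict_mono_less_eq[OF \<tau>(2), of 0 k] by simp
  have \<sigma>_eq: "\<sigma> (Suc k) = real (Suc i) * h" if "real i * h < \<tau> k" "\<tau> k \<le> real (Suc i) * h" for k i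
  proof -
    have "\<lceil>\<tau> k / h\<rceil> = int (Suc i)"
      by (rule ceiling_unique) (use that h in \<open>auto simp: field_simps\<close>)
    then show ?thesis by (simp add: \<sigma>_def)
  qed
  have c0: "c i = 0 \<longleftrightarrow> N (real i * h) = N (real (Suc i) * h)" for i
  proof -
    have "{k. \<tau> k \<in> {real i * h<..real (Suc i) * h}} = {N (real i * h)..<N (real (Suc i) * h)}"
      using N[of _ "real i * h"] N[of _ "real (Suc i) * h"] by (auto simp flip: not_le)
    moreover have "N (real i * h) \<le> N (real (Suc i) * h)"
      using N[of "N (real i * h) - 1" "real i * h"] N[of "N (real i * h) - 1" "real (Suc i) * h"] h
      by (cases "N (real i * h)") (auto simp: algebra_simps)
    ultimately show ?thesis by (auto simp: c_def)
  qed
  show ?thesis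
  proof (induction i)
    case 0
    \<comment> \<open>an event at time zero belongs to no cell, but it resets a velocity that is already zero\<close>
    have "k \<le> N 0 \<Longrightarrow> \<sigma> k = 0 \<and> reset_position \<sigma> x k = x" for k
    proof (induction k)
      case (Suc k)
      then have "\<tau> k = 0" using N[of k 0] \<tau>0[of k] by simp
      with Suc show ?case by (simp add: \<sigma>_def)
    qed (simp add: \<sigma>_def)
    from this[of "N 0"] show ?case by simp
  next
    case (Suc i)
    let ?n = "N (real i * h)" and ?m = "N (real (Suc i) * h)"
    let ?w = "grid_chain h c (x, 0) i"
    have add: "flow h ?w = flow (real (Suc i) * h - \<sigma> ?n) (reset_position \<sigma> x ?n, 0)"
      using flow_add[of h "real i * h - \<sigma> ?n" "(reset_position \<sigma> x ?n, 0)"] Suc h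
      by (simp add: algebra_simps)
    show ?case
    proof (cases "?n = ?m")
      case True
      then show ?thesis using add c0[of i] Suc h by (auto simp: algebra_simps)
    next
      case False
      \<comment> \<open>All events in this cell are rounded to its right end: the first of them carries the
        chain there, the others are resets after a flow of duration zero.\<close>
      have jump: "k < ?m \<Longrightarrow> \<sigma> (Suc k) = real (Suc i) * h" if "?n \<le> k" for k
        using \<sigma>_eq[of i k] N[of k "real i * h"] N[of k "real (Suc i) * h"] that by auto
      have pos: "k < ?m \<Longrightarrow> reset_position \<sigma> x (Suc k) = fst (flow h ?w)" if "?n \<le> k" for k
        using that
      proof (induction k rule: dec_induct)
        case base
        then show ?case using add jump[of ?n] by simp
      next
        case (step k)
        then have "\<sigma> (Suc (Suc k)) - \<sigma> (Suc k) = 0" using jump[of k] jump[of "Suc k"] by simp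
        then show ?case using step by (simp del: reset_position.simps add: reset_position.simps(2)[of _ _ "Suc k"])
      qed
      have "?n \<le> ?m"
        using N[of "?n - 1" "real i * h"] N[of "?n - 1" "real (Suc i) * h"] h
        by (cases ?n) (auto simp: algebra_simps)
      with False obtain m where m: "?m = Suc m" "?n \<le> m"
        by (metis Suc_leI Suc_le_mono le_neq_implies_less less_imp_Suc_add order_refl le_add1 add_Suc_right)
      then have "\<sigma> ?m = real (Suc i) * h" "reset_position \<sigma> x ?m = fst (flow h ?w)"
        using jump[of m] pos[of m] by auto
      then show ?thesis using c0[of i] False by (simp add: refresh_def)
    qed
  qed
qed

lemma reset_position_tendsto:
  assumes "\<And>k. (\<lambda>n. \<sigma> n k) \<longlonglongrightarrow> \<theta> k" "\<And>n k. \<sigma> n k \<le> \<sigma> n (Suc k)"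
  shows "(\<lambda>n. reset_position (\<sigma> n) x k) \<longlonglongrightarrow> reset_position \<theta> x k"
proof (induction k)
  case (Suc k)
  have "(\<lambda>n. flow (\<sigma> n (Suc k) - \<sigma> n k) (reset_position (\<sigma> n) x k, 0))
      \<longlonglongrightarrow> flow (\<theta> (Suc k) - \<theta> k) (reset_position \<theta> x k, 0)"
    by (intro flow_tendsto tendsto_Pair Suc tendsto_const tendsto_diff assms(1)) (simp add: assms(2))
  then show ?case by (auto intro: tendsto_fst)
qed simp

text \<open>
  As the grid is refined the rounded event times converge, and so do, by continuity of the flow
  map, the positions at the finitely many resets before time \<open>t\<close> and the state at time \<open>t\<close>.
\<close>

lemma grid_chain_tendsto_path:
  fixes \<tau> :: "nat \<Rightarrow> real"
  assumes path: "randomized_hamiltonian_path f \<tau> X Y" and X0: "X 0 = x" and Y0: "Y 0 = 0"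
    and \<tau>: "0 \<le> \<tau> 0" "strict_mono \<tau>" "filterlim \<tau> at_top sequentially"
    and t: "t > 0"
  defines "h \<equiv> \<lambda>n. t / real (Suc n)"
  defines "c \<equiv> \<lambda>n i. card {k. \<tau> k \<in> {real i * h n<..real (Suc i) * h n}}"
  shows "(\<lambda>n. grid_chain (h n) (c n) (x, 0) (Suc n)) \<longlonglongrightarrow> (X t, Y t)"
proof -
  define \<theta> where "\<theta> = case_nat 0 \<tau>"
  define \<sigma> where "\<sigma> = (\<lambda>n. case_nat 0 (\<lambda>k. h n * of_int \<lceil>\<tau> k / h n\<rceil>))"
  define N where "N = (LEAST k. t < \<tau> k)"
  have h: "h n > 0" for n using t by (simp add: h_def)
  have hS: "real (Suc n) * h n = t" for n by (simp add: h_def)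
  have N: "\<tau> k \<le> t \<longleftrightarrow> k < N" for k
    unfolding N_def by (rule le_event_time_iff_less_Least[OF \<tau>(2,3)])
  have \<sigma>_bd: "\<tau> k \<le> \<sigma> n (Suc k) \<and> \<sigma> n (Suc k) \<le> \<tau> k + h n" for n k
  proof -
    have "\<tau> k / h n \<le> of_int \<lceil>\<tau> k / h n\<rceil>" "of_int \<lceil>\<tau> k / h n\<rceil> \<le> \<tau> k / h n + 1"
      by linarith+
    from mult_left_mono[OF this(1), of "h n"] mult_left_mono[OF this(2), of "h n"]
    show ?thesis using h[of n] by (simp add: \<sigma>_def distrib_left)
  qed
  have h0: "h \<longlonglongrightarrow> 0"
    unfolding h_def using LIMSEQ_Suc[OF lim_const_over_n[of t]] by simp
  have \<sigma>_lim: "(\<lambda>n. \<sigma> n k) \<longlonglongrightarrow> \<theta> k" for k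
  proof (cases k)
    case (Suc j)
    have "(\<lambda>n. \<sigma> n (Suc j)) \<longlonglongrightarrow> \<tau> j"
      by (rule tendsto_sandwich[where f="\<lambda>n. \<tau> j" and h="\<lambda>n. \<tau> j + h n"])
        (use \<sigma>_bd tendsto_add[OF tendsto_const h0, of "\<tau> j"] in auto)
    then show ?thesis by (simp add: Suc \<theta>_def)
  qed (simp add: \<sigma>_def \<theta>_def)
  have \<sigma>_mono: "\<sigma> n k \<le> \<sigma> n (Suc k)" for n k
  proof (cases k)
    case (Suc j)
    have "\<tau> j / h n \<le> \<tau> (Suc j) / h n"
      using h[of n] strict_mono_less_eq[OF \<tau>(2)] by (intro divide_right_mono) auto
    then show ?thesis using h[of n] by (simp add: Suc \<sigma>_def ceiling_mono)
  next
    case 0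
    then show ?thesis using \<sigma>_bd[of 0 n] \<tau>(1) by (simp add: \<sigma>_def)
  qed
  have eq: "\<sigma> n N \<le> t \<and> grid_chain (h n) (c n) (x, 0) (Suc n) = flow (t - \<sigma> n N) (reset_position (\<sigma> n) x N, 0)" for n
    using grid_chain_eq_flow[OF h[of n] \<tau>, of "Suc n" x] unfolding hS N_def \<sigma>_def c_def .
  have "(\<lambda>n. flow (t - \<sigma> n N) (reset_position (\<sigma> n) x N, 0)) \<longlonglongrightarrow> flow (t - \<theta> N) (reset_position \<theta> x N, 0)"
    by (intro flow_tendsto tendsto_Pair tendsto_diff tendsto_const \<sigma>_lim reset_position_tendsto \<sigma>_mono)
      (use eq in auto)
  moreover have "\<theta> N \<le> t" using N t by (cases N) (auto simp: \<theta>_def)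
  moreover have "t < \<theta> (Suc N)" using N[of N] by (simp add: \<theta>_def)
  ultimately show ?thesis
    using eq randomized_hamiltonian_path_eq_flow(2)[OF path X0 Y0 \<tau>(1,2), of N t]
    by (simp add: \<theta>_def del: grid_chain.simps)
qed

end


section \<open>Poisson events on a grid\<close>

lemma set_integral_refreshment_rate:
  fixes a b :: real
  assumes "0 \<le> a" "a \<le> b"
  shows "(LINT s:{a<..b}|lborel. 6 / (s + 1)) = 6 * ln ((b + 1) / (a + 1))"
proof -
  have "(LINT s:{a<..b}|lborel. 6 / (s + 1)) = (LBINT s=a..b. 6 / (s + 1))"
    using assms by (simp add: interval_integral_Ioc)
  also have "\<dots> = 6 * ln (b + 1) - 6 * ln (a + 1)"
  proof (rule interval_integral_FTC_finite)
    show "continuous_on {min a b..max a b} (\<lambda>s. 6 / (s + 1))"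
      using assms by (intro continuous_intros) auto
    show "((\<lambda>s. 6 * ln (s + 1)) has_vector_derivative 6 / (s + 1)) (at s within {min a b..max a b})"
      if "min a b \<le> s" "s \<le> max a b" for s
      using assms that unfolding has_real_derivative_iff_has_vector_derivative[symmetric]
      by (auto intro!: derivative_eq_intros)
  qed
  also have "\<dots> = 6 * ln ((b + 1) / (a + 1))"
    using assms by (simp add: ln_div algebra_simps)
  finally show ?thesis .
qed

text \<open>
  With rate \<open>6 / (t + 1)\<close>, the probability of no event between \<open>s - 1\<close> and \<open>s + h - 1\<close> is the number \<open>p\<close>
  below. A reset with probability \<open>1 - p\<close> thus cancels the drift accumulated over time \<open>h\<close> up to second
  order.
\<close>

lemma jump_probability_estimate:
  fixes s h :: real
  assumes "1 \<le> s" "0 \<le> h"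
  defines "p \<equiv> (s / (s + h)) ^ 6"
  shows "0 \<le> h - (1 - p) * (s + h) / 6" and "h - (1 - p) * (s + h) / 6 \<le> 3 * h\<^sup>2"
proof -
  define x where "x = h / (s + h)"
  have x: "0 \<le> x" "x \<le> 1" and hx: "h = (s + h) * x" using assms by (auto simp: x_def)
  have p: "p = (1 - x) ^ 6" unfolding p_def x_def using assms by (simp add: field_simps)
  have "1 - 6 * x \<le> p"
    using Bernoulli_inequality[of "- x" 6] x by (simp add: p)
  then have "(1 - p) * (s + h) \<le> (6 * x) * (s + h)"
    using assms by (intro mult_right_mono) auto
  then show "0 \<le> h - (1 - p) * (s + h) / 6" using hx by (simp add: algebra_simps)
  have "1 - 6 * x + 15 * x\<^sup>2 - p = x ^ 3 * (20 - 15 * x + 6 * x\<^sup>2 - x ^ 3)"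
    unfolding p by (simp add: power2_eq_square eval_nat_numeral algebra_simps)
  also have "\<dots> \<ge> 0"
  proof (rule mult_nonneg_nonneg)
    show "0 \<le> 20 - 15 * x + 6 * x\<^sup>2 - x ^ 3"
      using x power_le_one[of x 3] zero_le_power2[of x] by linarith
  qed (use x in simp)
  finally have "6 * x - 15 * x\<^sup>2 \<le> 1 - p" by simp
  then have est: "(6 * x - 15 * x\<^sup>2) * (s + h) \<le> (1 - p) * (s + h)"
    using assms by (intro mult_right_mono) auto
  have "(6 * x - 15 * x\<^sup>2) * (s + h) = 6 * ((s + h) * x) - 15 * ((s + h) * x * x)"
    by (simp add: algebra_simps power2_eq_square)
  with est have "h - (1 - p) * (s + h) / 6 \<le> 15 / 6 * (h * x)"
    unfolding hx[symmetric] by simp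
  also have "\<dots> \<le> 3 * (h * h)"
  proof -
    have "x \<le> h" unfolding x_def using assms by (simp add: pos_divide_le_eq mult_le_cancel_left1)
    then have "h * x \<le> h * h" using assms by (intro mult_left_mono) auto
    then show ?thesis using zero_le_square[of h] by linarith
  qed
  finally show "h - (1 - p) * (s + h) / 6 \<le> 3 * h\<^sup>2" by (simp add: power2_eq_square)
qed

text \<open>
  The cells \<open>(i h, (i + 1) h]\<close> are disjoint, so the numbers of events in them are independent.
\<close>

lemma poisson_counts:
  assumes P: "poisson_point_process M (\<lambda>s. 6 / (s + 1)) T" and h: "0 \<le> h"
  defines "N \<equiv> \<lambda>i. event_count T {real i * h<..real (Suc i) * h}"
  shows poisson_counts_indep: "prob_space.indep_vars M (\<lambda>_. count_space UNIV) N {..<m}"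
    and poisson_counts_prob_0:
      "measure M {\<omega>\<in>space M. N i \<omega> = 0} = ((1 + real i * h) / (1 + real i * h + h)) ^ 6"
proof -
  let ?A = "\<lambda>i. {real i * h<..real (Suc i) * h}"
  have grid: "0 \<le> real i * h" "real i * h \<le> real (Suc i) * h" for i
    using h by (auto intro!: mult_right_mono simp del: of_nat_Suc)
  have A: "?A i \<in> sets borel \<and> ?A i \<subseteq> {0..} \<and> bounded (?A i)" for i
  proof (intro conjI)
    show "?A i \<subseteq> {0..}" using grid(1)[of i] by auto
    show "bounded (?A i)"
      by (rule bounded_subset[OF bounded_closed_interval[of "real i * h" "real (Suc i) * h"]]) auto
  qed simp
  have disj: "disjoint_family_on ?A {..<m}"
  proof -
    have "?A i \<inter> ?A j = {}" if "i < j" for i j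
    proof -
      have "real (Suc i) * h \<le> real j * h" using that h by (intro mult_right_mono) auto
      then show ?thesis by auto
    qed
    then show ?thesis
      unfolding disjoint_family_on_def by (metis Int_commute nat_neq_iff)
  qed
  show "prob_space.indep_vars M (\<lambda>_. count_space UNIV) N {..<m}"
  proof -
    have "\<forall>n (A :: nat \<Rightarrow> real set).
        (\<forall>i<n. A i \<in> sets borel \<and> A i \<subseteq> {0..} \<and> bounded (A i)) \<and> disjoint_family_on A {..<n} \<longrightarrow>
        prob_space.indep_vars M (\<lambda>_. count_space UNIV) (\<lambda>i. event_count T (A i)) {..<n}"
      using P unfolding poisson_point_process_def by (elim conjE)
    from this[rule_format, of m ?A] A disj show ?thesis
      unfolding N_def by blast
  qed
  have "measure M {\<omega>\<in>space M. event_count T (?A i) \<omega> = 0} =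
      (LINT t:?A i|lborel. 6 / (t + 1)) ^ 0 / fact 0 * exp (- (LINT t:?A i|lborel. 6 / (t + 1)))"
  proof -
    have "\<forall>A\<in>sets borel. A \<subseteq> {0..} \<and> bounded A \<longrightarrow>
        (\<forall>n. measure M {\<omega>\<in>space M. event_count T A \<omega> = n} =
          (LINT t:A|lborel. 6 / (t + 1)) ^ n / fact n * exp (- (LINT t:A|lborel. 6 / (t + 1))))"
      using P unfolding poisson_point_process_def by (elim conjE)
    from this[rule_format, of "?A i" 0] A[of i] show ?thesis
      by blast
  qed
  also have "(LINT t:?A i|lborel. 6 / (t + 1)) = 6 * ln ((real (Suc i) * h + 1) / (real i * h + 1))"
    by (intro set_integral_refreshment_rate grid)
  also have "exp (- (6 * ln ((real (Suc i) * h + 1) / (real i * h + 1))))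
      = ((1 + real i * h) / (1 + real i * h + h)) ^ 6"
  proof -
    have pos: "0 < real i * h + 1" "0 < real (Suc i) * h + 1"
      using grid(1)[of i] grid(1)[of "Suc i"] by linarith+
    have "exp (- (6 * ln ((real (Suc i) * h + 1) / (real i * h + 1))))
       = exp (real 6 * ln ((real i * h + 1) / (real (Suc i) * h + 1)))"
      using pos by (simp add: ln_div)
    also have "\<dots> = exp (ln ((real i * h + 1) / (real (Suc i) * h + 1))) ^ 6"
      by (rule exp_of_nat_mult)
    also have "\<dots> = ((1 + real i * h) / (1 + real i * h + h)) ^ 6"
      using pos by (simp add: algebra_simps)
    finally show ?thesis .
  qed
  finally show "measure M {\<omega>\<in>space M. N i \<omega> = 0} = ((1 + real i * h) / (1 + real i * h + h)) ^ 6"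
    by (simp add: N_def)
qed


section \<open>Expected decay of the Lyapunov function\<close>

context convex_hamiltonian_system
begin

lemma grid_chain_cong:
  "(\<And>j. j < i \<Longrightarrow> c j = c' j) \<Longrightarrow> grid_chain h c z i = grid_chain h c' z i"
  by (induction i) auto

text \<open>
  Only whether a cell is empty matters, so the chain takes finitely many values at each step and
  every function of it is bounded.
\<close>

lemma finite_range_grid_chain: "finite (range (\<lambda>c. grid_chain h c z i))"
proof (induction i)
  case (Suc i)
  let ?R = "range (\<lambda>c. grid_chain h c z i)"
  have "range (\<lambda>c. grid_chain h c z (Suc i)) \<subseteq> flow h ` ?R \<union> refresh ` flow h ` ?R"
    by auto
  then show ?case by (rule finite_subset) (use Suc in auto)
qed auto

text \<open>
  Arbitrary functions \<open>g\<close> of the state are measurable in the counts, because the state depends on them only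
  through finitely many case distinctions.
\<close>

lemma measurable_grid_chain:
  fixes g :: "'a \<times> 'a \<Rightarrow> real"
  assumes "{..<i} \<subseteq> J"
  shows "(\<lambda>c. g (grid_chain h c z i)) \<in> borel_measurable (PiM J (\<lambda>_. count_space UNIV))"
  using assms
proof (induction i arbitrary: g)
  case (Suc i)
  then have i: "i \<in> J" "{..<i} \<subseteq> J" by auto
  have [measurable]: "(\<lambda>c. c i) \<in> measurable (PiM J (\<lambda>_. count_space UNIV)) (count_space (UNIV :: nat set))"
    using i(1) by (rule measurable_component_singleton)
  have "(\<lambda>c. if c i = 0 then g (flow h (grid_chain h c z i))
      else g (refresh (flow h (grid_chain h c z i)))) \<in> borel_measurable (PiM J (\<lambda>_. count_space UNIV))"
    by (intro measurable_If Suc.IH[OF i(2), of "\<lambda>w. g (flow h w)"]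
        Suc.IH[OF i(2), of "\<lambda>w. g (refresh (flow h w))"]) measurable
  then show ?case by (simp add: if_distrib[of g])
qed simp

text \<open>
  The state before cell \<open>i\<close> is a function of the counts in the earlier cells, hence independent of
  whether cell \<open>i\<close> is empty.
\<close>

lemma
  fixes g :: "'a \<times> 'a \<Rightarrow> real" and N :: "nat \<Rightarrow> 'w \<Rightarrow> nat"
  assumes M: "prob_space M"
    and ind: "prob_space.indep_vars M (\<lambda>_. count_space UNIV) N {..<m}" and i: "i \<le> m"
  shows integrable_grid_chain: "integrable M (\<lambda>\<omega>. g (grid_chain h (\<lambda>j. N j \<omega>) z i))"
    and indep_grid_chain: "i < m \<Longrightarrow> prob_space.indep_var M borel
      (\<lambda>\<omega>. g (grid_chain h (\<lambda>j. N j \<omega>) z i)) borel (\<lambda>\<omega>. indicator {0} (N i \<omega>) :: real)"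
proof -
  interpret prob_space M by fact
  let ?P = "\<lambda>J. PiM J (\<lambda>_. count_space (UNIV :: nat set))"
  have N: "N j \<in> measurable M (count_space UNIV)" if "j < m" for j
    using ind that by (simp add: indep_vars_def)
  have restr: "(\<lambda>\<omega>. \<lambda>j\<in>{..<i}. N j \<omega>) \<in> measurable M (?P {..<i})"
    using N i by (intro measurable_restrict) auto
  have eq: "g (grid_chain h (\<lambda>j\<in>{..<i}. N j \<omega>) z i) = g (grid_chain h (\<lambda>j. N j \<omega>) z i)" for \<omega>
    by (intro arg_cong[of _ _ g] grid_chain_cong) auto
  have meas: "(\<lambda>\<omega>. g (grid_chain h (\<lambda>j. N j \<omega>) z i)) \<in> borel_measurable M"
    using measurable_compose[OF restr measurable_grid_chain[of i "{..<i}" g h z]] by (simp add: eq)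
  have fin: "finite ((\<lambda>c. norm (g (grid_chain h c z i))) ` UNIV)"
    using finite_imageI[OF finite_range_grid_chain[of h z i], of "\<lambda>z. norm (g z)"]
    by (simp add: image_image)
  show "integrable M (\<lambda>\<omega>. g (grid_chain h (\<lambda>j. N j \<omega>) z i))"
  proof (rule integrable_const_bound[OF _ meas])
    show "AE \<omega> in M. norm (g (grid_chain h (\<lambda>j. N j \<omega>) z i)) \<le> Max (range (\<lambda>c. norm (g (grid_chain h c z i))))"
      by (intro AE_I2 Max_ge[OF fin]) auto
  qed
  assume im: "i < m"
  have "indep_var (?P {..<i}) (\<lambda>\<omega>. \<lambda>j\<in>{..<i}. N j \<omega>) (?P {i}) (\<lambda>\<omega>. \<lambda>j\<in>{i}. N j \<omega>)"
    using im by (intro indep_var_restrict[OF ind]) auto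
  then have "indep_var borel ((\<lambda>c. g (grid_chain h c z i)) \<circ> (\<lambda>\<omega>. \<lambda>j\<in>{..<i}. N j \<omega>))
      borel ((\<lambda>c. indicator {0} (c i) :: real) \<circ> (\<lambda>\<omega>. \<lambda>j\<in>{i}. N j \<omega>))"
  proof (rule indep_var_compose)
    have "(\<lambda>c. c i) \<in> measurable (?P {i}) (count_space UNIV)"
      by (rule measurable_component_singleton) simp
    then show "(\<lambda>c. indicator {0} (c i) :: real) \<in> borel_measurable (?P {i})"
      by (rule measurable_compose) simp
  qed (rule measurable_grid_chain, simp)
  then show "indep_var borel (\<lambda>\<omega>. g (grid_chain h (\<lambda>j. N j \<omega>) z i)) borel (\<lambda>\<omega>. indicator {0} (N i \<omega>) :: real)"
    by (simp add: comp_def eq)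
qed

lemma expectation_grid_chain_Suc:
  fixes g :: "'a \<times> 'a \<Rightarrow> real" and N :: "nat \<Rightarrow> 'w \<Rightarrow> nat" and h :: real and z :: "'a \<times> 'a"
  assumes M: "prob_space M"
    and ind: "prob_space.indep_vars M (\<lambda>_. count_space UNIV) N {..<m}" and i: "i < m"
  defines "p \<equiv> measure M {\<omega>\<in>space M. N i \<omega> = 0}" and "Z \<equiv> \<lambda>i \<omega>. grid_chain h (\<lambda>j. N j \<omega>) z i"
  shows "(\<integral>\<omega>. g (Z (Suc i) \<omega>) \<partial>M)
    = p * (\<integral>\<omega>. g (flow h (Z i \<omega>)) \<partial>M) + (1 - p) * (\<integral>\<omega>. g (refresh (flow h (Z i \<omega>))) \<partial>M)"
proof -
  interpret prob_space M by fact
  define b where "b = (\<lambda>\<omega>. indicator {0} (N i \<omega>) :: real)"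
  have "N i \<in> measurable M (count_space UNIV)" using ind i by (simp add: indep_vars_def)
  then have b_meas: "b \<in> borel_measurable M"
    unfolding b_def by (rule measurable_compose) simp
  have b_int: "integrable M b"
    by (rule integrable_const_bound[OF _ b_meas, of 1]) (auto simp: b_def indicator_def)
  have "(\<integral>\<omega>. b \<omega> \<partial>M) = (\<integral>\<omega>. indicator {\<omega>\<in>space M. N i \<omega> = 0} \<omega> \<partial>M)"
    by (intro Bochner_Integration.integral_cong) (auto simp: b_def indicator_def)
  then have b_exp: "(\<integral>\<omega>. b \<omega> \<partial>M) = p" by (simp add: p_def Int_def conj_commute)
  have int: "integrable M (\<lambda>\<omega>. u (Z i \<omega>))" for u :: "'a \<times> 'a \<Rightarrow> real"
    unfolding Z_def using i by (intro integrable_grid_chain[OF M ind]) simp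
  have prod: "integrable M (\<lambda>\<omega>. u (Z i \<omega>) * b \<omega>)"
    "(\<integral>\<omega>. u (Z i \<omega>) * b \<omega> \<partial>M) = (\<integral>\<omega>. u (Z i \<omega>) \<partial>M) * p" for u :: "'a \<times> 'a \<Rightarrow> real"
  proof -
    have "indep_var borel (\<lambda>\<omega>. u (Z i \<omega>)) borel b"
      unfolding Z_def b_def using i by (intro indep_grid_chain[OF M ind]) simp_all
    from indep_var_integrable[OF this int b_int] indep_var_lebesgue_integral[OF this int b_int] b_exp
    show "integrable M (\<lambda>\<omega>. u (Z i \<omega>) * b \<omega>)"
      "(\<integral>\<omega>. u (Z i \<omega>) * b \<omega> \<partial>M) = (\<integral>\<omega>. u (Z i \<omega>) \<partial>M) * p" by simp_all
  qed
  \<comment> \<open>\<open>b\<close> indicates that no event occurs in the cell, and is independent of the state before it\<close>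
  define u where "u = (\<lambda>z. g (flow h z))"
  define v where "v = (\<lambda>z. g (refresh (flow h z)))"
  have "g (Z (Suc i) \<omega>) = u (Z i \<omega>) * b \<omega> + (v (Z i \<omega>) - v (Z i \<omega>) * b \<omega>)" for \<omega>
    by (simp add: Z_def u_def v_def b_def)
  then have "(\<integral>\<omega>. g (Z (Suc i) \<omega>) \<partial>M) = (\<integral>\<omega>. u (Z i \<omega>) \<partial>M) * p
      + ((\<integral>\<omega>. v (Z i \<omega>) \<partial>M) - (\<integral>\<omega>. v (Z i \<omega>) \<partial>M) * p)"
    using prod[of u] prod[of v] int[of v] by simp
  then show ?thesis by (simp add: u_def v_def algebra_simps)
qed

text \<open>
  Per step the drift and the expected reset cancel up to \<open>O(h\<^sup>2)\<close>, uniformly in the step because the energy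
  bounds all states of the chain. Over \<open>t / h\<close> steps the error accumulates only to \<open>O(h)\<close>.
\<close>

lemma expectation_lyapunov_grid_chain:
  assumes M: "prob_space M" and P: "poisson_point_process M (\<lambda>s. 6 / (s + 1)) T" and t: "0 \<le> t"
  shows "\<exists>C. \<forall>m h i. 0 \<le> h \<and> real m * h = t \<and> i \<le> m \<longrightarrow>
    (\<integral>\<omega>. lyapunov (1 + real i * h)
        (grid_chain h (\<lambda>j. event_count T {real j * h<..real (Suc j) * h} \<omega>) z i) \<partial>M)
      \<le> lyapunov 1 z + real i * (C * h\<^sup>2)"
proof -
  interpret prob_space M by fact
  define V where "V = sqrt (2 * energy z)"
  define D where "D = norm (fst z - xstar) + t * V"
  define S where "S = 1 + t"
  have V0: "V \<ge> 0" using energy_nonneg[of z] by (simp add: V_def)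
  obtain G where G: "G \<ge> 0" "\<And>x. norm x \<le> norm xstar + D \<Longrightarrow> norm (gradient f x) \<le> G"
    using gradient_bounded_on_ball by blast
  have G': "norm (gradient f x) \<le> G" if "norm (x - xstar) \<le> D" for x
    using G(2)[of x] norm_triangle_sub[of x xstar] that by simp
  define C1 where "C1 = 15 * V\<^sup>2 + 6 * S * (V * G) + 12 * (G * D)"
  define K where "K = 3 * S * V\<^sup>2 + 12 * (V * D)"
  have main: "(\<integral>\<omega>. lyapunov (1 + real i * h) (grid_chain h (\<lambda>j. N j \<omega>) z i) \<partial>M)
      \<le> lyapunov 1 z + real i * ((C1 + 3 * K) * h\<^sup>2)"
    if h: "0 \<le> h" and mh: "real m * h = t" and i: "i \<le> m"
      and N_def: "N = (\<lambda>j. event_count T {real j * h<..real (Suc j) * h})" for m i :: nat and h N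
  proof -
    let ?Z = "\<lambda>i \<omega>. grid_chain h (\<lambda>j. N j \<omega>) z i"
    have ind: "indep_vars (\<lambda>_. count_space UNIV) N {..<m}"
      unfolding N_def by (rule poisson_counts_indep[OF P h])
    have bounds: "energy (?Z i \<omega>) \<le> energy z" "norm (fst (?Z i \<omega>) - xstar) + h * V \<le> D" if "i < m" for i \<omega>
    proof -
      show "energy (?Z i \<omega>) \<le> energy z" by (rule energy_grid_chain_le[OF h])
      have "norm (fst (?Z i \<omega>) - xstar) \<le> norm (fst (?Z i \<omega>) - fst z) + norm (fst z - xstar)"
        using dist_triangle[of "fst (?Z i \<omega>)" xstar "fst z"] by (simp add: dist_norm)
      moreover have "norm (fst (?Z i \<omega>) - fst z) \<le> real i * h * V"
        unfolding V_def by (rule norm_grid_chain_diff_le[OF h])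
      moreover have "real (Suc i) * h * V \<le> t * V"
        unfolding mh[symmetric] using that h V0 by (intro mult_right_mono) auto
      ultimately show "norm (fst (?Z i \<omega>) - xstar) + h * V \<le> D"
        by (simp add: D_def algebra_simps)
    qed
    from i show ?thesis
    proof (induction i)
      case (Suc i)
      then have im: "i < m" by simp
      define s where "s = 1 + real i * h"
      define p where "p = prob {\<omega>\<in>space M. N i \<omega> = 0}"
      have s1: "1 \<le> s" using h by (simp add: s_def)
      have sh: "s + h = 1 + real (Suc i) * h" by (simp add: s_def algebra_simps)
      have "real (Suc i) * h \<le> t" unfolding mh[symmetric] using im h by (intro mult_right_mono) auto
      then have sS: "s + h \<le> S" unfolding sh S_def by simp
      have p: "p = (s / (s + h)) ^ 6"
        unfolding p_def N_def s_def by (rule poisson_counts_prob_0[OF P h])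
      \<comment> \<open>what remains of the drift after the expected reset of this step\<close>
      define d where "d = h - (1 - p) * (s + h) / 6"
      have d: "0 \<le> d" "d \<le> 3 * h\<^sup>2"
        unfolding d_def p by (intro jump_probability_estimate s1 h)+
      let ?w = "\<lambda>\<omega>. flow h (?Z i \<omega>)"
      have drift: "drift (s + h) (?w \<omega>) \<le> K" for \<omega>
      proof -
        have "norm (snd (?w \<omega>)) \<le> sqrt (2 * energy (?Z i \<omega>))"
          using norm_snd_le_energy[of "?w \<omega>"] h by simp
        also have "\<dots> \<le> V" using bounds(1)[OF im] by (simp add: V_def)
        finally have y: "norm (snd (?w \<omega>)) \<le> V" .
        have "norm (fst (?w \<omega>) - xstar) \<le> norm (fst (?w \<omega>) - fst (?Z i \<omega>)) + norm (fst (?Z i \<omega>) - xstar)"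
          using dist_triangle[of "fst (?w \<omega>)" xstar "fst (?Z i \<omega>)"] by (simp add: dist_norm)
        also have "norm (fst (?w \<omega>) - fst (?Z i \<omega>)) \<le> h * sqrt (2 * energy (?Z i \<omega>))"
          by (rule norm_fst_flow_diff_le[OF h])
        also have "\<dots> \<le> h * V"
          using bounds(1)[OF im] h by (intro mult_left_mono) (simp_all add: V_def)
        finally have x: "norm (fst (?w \<omega>) - xstar) \<le> D" using bounds(2)[OF im, of \<omega>] by simp
        have "inner (snd (?w \<omega>)) (snd (?w \<omega>)) \<le> V\<^sup>2"
          using y by (simp add: dot_square_norm power_mono)
        then have "(s + h) * inner (snd (?w \<omega>)) (snd (?w \<omega>)) \<le> S * V\<^sup>2"
          using sS s1 h by (intro mult_mono) auto
        moreover have "inner (snd (?w \<omega>)) (fst (?w \<omega>) - xstar) \<le> V * D"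
          using norm_cauchy_schwarz[of "snd (?w \<omega>)" "fst (?w \<omega>) - xstar"] mult_mono[OF y x V0]
          by simp
        ultimately show ?thesis unfolding drift_def K_def mult.assoc by linarith
      qed
      have int: "integrable M (\<lambda>\<omega>. u (?Z i \<omega>))" for u :: "'a \<times> 'a \<Rightarrow> real"
        using im by (intro integrable_grid_chain[OF M ind]) simp
      have "(\<integral>\<omega>. lyapunov (s + h) (?Z (Suc i) \<omega>) \<partial>M)
          = p * (\<integral>\<omega>. lyapunov (s + h) (?w \<omega>) \<partial>M)
            + (1 - p) * (\<integral>\<omega>. lyapunov (s + h) (refresh (?w \<omega>)) \<partial>M)"
        unfolding p_def by (rule expectation_grid_chain_Suc[OF M ind im])
      also have "\<dots> = (\<integral>\<omega>. p * lyapunov (s + h) (?w \<omega>) + (1 - p) * lyapunov (s + h) (refresh (?w \<omega>)) \<partial>M)"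
        using int[of "\<lambda>w. lyapunov (s + h) (flow h w)"] int[of "\<lambda>w. lyapunov (s + h) (refresh (flow h w))"]
        by simp
      also have "\<dots> \<le> (\<integral>\<omega>. lyapunov s (?Z i \<omega>) + (C1 + 3 * K) * h\<^sup>2 \<partial>M)"
      proof (rule integral_mono)
        show "integrable M (\<lambda>\<omega>. p * lyapunov (s + h) (?w \<omega>) + (1 - p) * lyapunov (s + h) (refresh (?w \<omega>)))"
          using int[of "\<lambda>w. p * lyapunov (s + h) (flow h w) + (1 - p) * lyapunov (s + h) (refresh (flow h w))"]
          by simp
        show "integrable M (\<lambda>\<omega>. lyapunov s (?Z i \<omega>) + (C1 + 3 * K) * h\<^sup>2)"
          using int[of "\<lambda>w. lyapunov s w + (C1 + 3 * K) * h\<^sup>2"] by simp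
        fix \<omega>
        have "lyapunov (s + h) (?w \<omega>) \<le> lyapunov s (?Z i \<omega>) + h * drift (s + h) (?w \<omega>) + C1 * h\<^sup>2"
          unfolding C1_def V_def
          by (rule lyapunov_step[where D=D]) (use h s1 sS bounds[OF im] G' in \<open>auto simp: V_def\<close>)
        moreover have "d * drift (s + h) (?w \<omega>) \<le> 3 * h\<^sup>2 * K"
        proof -
          have "d * drift (s + h) (?w \<omega>) \<le> d * K" using drift d(1) by (rule mult_left_mono)
          also have "\<dots> \<le> 3 * h\<^sup>2 * K"
            using d(2) by (rule mult_right_mono)
              (auto simp: K_def S_def D_def intro!: add_nonneg_nonneg mult_nonneg_nonneg V0 t)
          finally show ?thesis .
        qed
        moreover have "p * lyapunov (s + h) (?w \<omega>) + (1 - p) * lyapunov (s + h) (refresh (?w \<omega>))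
            = lyapunov (s + h) (?w \<omega>) - h * drift (s + h) (?w \<omega>) + d * drift (s + h) (?w \<omega>)"
          unfolding lyapunov_refresh d_def by (simp add: field_simps)
        ultimately show "p * lyapunov (s + h) (?w \<omega>) + (1 - p) * lyapunov (s + h) (refresh (?w \<omega>))
            \<le> lyapunov s (?Z i \<omega>) + (C1 + 3 * K) * h\<^sup>2"
          by (simp add: algebra_simps)
      qed
      also have "\<dots> = (\<integral>\<omega>. lyapunov s (?Z i \<omega>) \<partial>M) + (C1 + 3 * K) * h\<^sup>2"
        using int by (simp add: prob_space)
      also have "\<dots> \<le> lyapunov 1 z + real (Suc i) * ((C1 + 3 * K) * h\<^sup>2)"
        using Suc im by (simp add: s_def algebra_simps)
      finally show ?case unfolding sh .
    qed (simp add: prob_space)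
  qed
  show ?thesis
  proof (intro exI[of _ "C1 + 3 * K"] allI impI)
    fix m i :: nat and h :: real
    assume "0 \<le> h \<and> real m * h = t \<and> i \<le> m"
    then show "(\<integral>\<omega>. lyapunov (1 + real i * h)
        (grid_chain h (\<lambda>j. event_count T {real j * h<..real (Suc j) * h} \<omega>) z i) \<partial>M)
      \<le> lyapunov 1 z + real i * ((C1 + 3 * K) * h\<^sup>2)"
      by (elim conjE) (rule main[OF _ _ _ refl])
  qed
qed


section \<open>The rate of convergence\<close>

text \<open>
  Passing to the limit of fine grids: the states of the chain converge almost surely and the function
  gap is bounded by the initial energy, so dominated convergence applies.
\<close>

theorem randomized_hamiltonian_flow_convergence:
  fixes M :: "'w measure"
  assumes M: "prob_space M"
    and rhf: "randomized_hamiltonian_flow M f (\<lambda>s. 6 / (s + 1)) T X Y"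
    and init: "AE \<omega> in M. X 0 \<omega> = x \<and> Y 0 \<omega> = 0"
    and t: "t > 0"
  shows "integrable M (\<lambda>\<omega>. f (X t \<omega>) - f xstar)"
    and "(\<integral>\<omega>. f (X t \<omega>) - f xstar \<partial>M) \<le> (f x - f xstar + 5 * (norm (x - xstar))\<^sup>2) / (t + 1)\<^sup>2"
proof -
  interpret prob_space M by fact
  define h where "h = (\<lambda>n. t / real (Suc n))"
  define Z where "Z = (\<lambda>n \<omega>. grid_chain (h n)
      (\<lambda>i. event_count T {real i * h n<..real (Suc i) * h n} \<omega>) (x, 0) (Suc n))"
  have h: "0 \<le> h n" "real (Suc n) * h n = t" for n using t by (simp_all add: h_def)
  have P: "poisson_point_process M (\<lambda>s. 6 / (s + 1)) T"
    and X: "X t \<in> borel_measurable M"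
    and path: "AE \<omega> in M. randomized_hamiltonian_path f (\<lambda>k. T k \<omega>) (\<lambda>t. X t \<omega>) (\<lambda>t. Y t \<omega>)"
    using rhf t by (auto simp: randomized_hamiltonian_flow_def)
  have events: "AE \<omega> in M. 0 \<le> T 0 \<omega> \<and> strict_mono (\<lambda>k. T k \<omega>) \<and> filterlim (\<lambda>k. T k \<omega>) at_top sequentially"
    using P by (simp add: poisson_point_process_def)
  have f_meas: "f \<in> borel_measurable borel"
    by (intro borel_measurable_continuous_onI continuous_on_f)
  have Z_int: "integrable M (\<lambda>\<omega>. u (Z n \<omega>))" for n and u :: "'a \<times> 'a \<Rightarrow> real"
    unfolding Z_def by (rule integrable_grid_chain[OF M poisson_counts_indep[OF P h(1)] order_refl])
  have lim: "AE \<omega> in M. (\<lambda>n. f (fst (Z n \<omega>)) - f xstar) \<longlonglongrightarrow> f (X t \<omega>) - f xstar"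
    using path events init
  proof eventually_elim
    case (elim \<omega>)
    then have "(\<lambda>n. Z n \<omega>) \<longlonglongrightarrow> (X t \<omega>, Y t \<omega>)"
      unfolding Z_def event_count_def h_def by (intro grid_chain_tendsto_path t) auto
    from tendsto_fst[OF this] show ?case
      by (intro tendsto_diff tendsto_const continuous_on_tendsto_compose[OF continuous_on_f[of UNIV]]) auto
  qed
  have bound: "AE \<omega> in M. norm (f (fst (Z n \<omega>)) - f xstar) \<le> energy (x, 0)" for n
  proof (rule AE_I2)
    fix \<omega>
    have "f (fst (Z n \<omega>)) - f xstar \<le> energy (Z n \<omega>)" by (simp add: energy_def)
    also have "\<dots> \<le> energy (x, 0)" unfolding Z_def by (rule energy_grid_chain_le[OF h(1)])
    finally show "norm (f (fst (Z n \<omega>)) - f xstar) \<le> energy (x, 0)"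
      using minimizer[of "fst (Z n \<omega>)"] by simp
  qed
  have meas: "(\<lambda>\<omega>. f (X t \<omega>) - f xstar) \<in> borel_measurable M"
    using measurable_compose[OF X f_meas] by measurable
  have Z_meas: "(\<lambda>\<omega>. f (fst (Z n \<omega>)) - f xstar) \<in> borel_measurable M" for n
    using Z_int[of "\<lambda>z. f (fst z) - f xstar" n] by (rule borel_measurable_integrable)
  show "integrable M (\<lambda>\<omega>. f (X t \<omega>) - f xstar)"
    by (rule integrable_dominated_convergence[OF meas Z_meas _ lim bound]) simp
  have conv: "(\<lambda>n. \<integral>\<omega>. f (fst (Z n \<omega>)) - f xstar \<partial>M) \<longlonglongrightarrow> (\<integral>\<omega>. f (X t \<omega>) - f xstar \<partial>M)"
    by (rule integral_dominated_convergence[OF meas Z_meas _ lim bound]) simp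
  obtain C where C: "\<forall>m h i. 0 \<le> h \<and> real m * h = t \<and> i \<le> m \<longrightarrow>
    (\<integral>\<omega>. lyapunov (1 + real i * h)
        (grid_chain h (\<lambda>j. event_count T {real j * h<..real (Suc j) * h} \<omega>) (x, 0) i) \<partial>M)
      \<le> lyapunov 1 (x, 0) + real i * (C * h\<^sup>2)"
    using expectation_lyapunov_grid_chain[OF M P less_imp_le[OF t], of "(x, 0)"] by blast
  have le: "(1 + t)\<^sup>2 * (\<integral>\<omega>. f (fst (Z n \<omega>)) - f xstar \<partial>M) \<le> lyapunov 1 (x, 0) + C * t * h n" for n
  proof -
    have "(1 + t)\<^sup>2 * (\<integral>\<omega>. f (fst (Z n \<omega>)) - f xstar \<partial>M) = (\<integral>\<omega>. (1 + t)\<^sup>2 * (f (fst (Z n \<omega>)) - f xstar) \<partial>M)"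
      by simp
    also have "\<dots> \<le> (\<integral>\<omega>. lyapunov (1 + t) (Z n \<omega>) \<partial>M)"
      by (intro integral_mono lyapunov_ge Z_int[of "\<lambda>z. (1 + t)\<^sup>2 * (f (fst z) - f xstar)"] Z_int)
    also have "\<dots> \<le> lyapunov 1 (x, 0) + real (Suc n) * (C * (h n)\<^sup>2)"
      using C[rule_format, of "h n" "Suc n" "Suc n"] h(1)[of n] unfolding h(2) Z_def by blast
    also have "real (Suc n) * (C * (h n)\<^sup>2) = C * (real (Suc n) * h n) * h n"
      by (simp only: power2_eq_square ac_simps)
    finally show ?thesis unfolding h(2) .
  qed
  have h0: "h \<longlonglongrightarrow> 0"
    unfolding h_def using LIMSEQ_Suc[OF lim_const_over_n[of t]] by simp
  have "(1 + t)\<^sup>2 * (\<integral>\<omega>. f (X t \<omega>) - f xstar \<partial>M) \<le> lyapunov 1 (x, 0) + C * t * 0"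
    by (rule LIMSEQ_le[OF tendsto_mult[OF tendsto_const conv] tendsto_add[OF tendsto_const tendsto_mult[OF tendsto_const h0]]])
      (use le in blast)
  then show "(\<integral>\<omega>. f (X t \<omega>) - f xstar \<partial>M) \<le> (f x - f xstar + 5 * (norm (x - xstar))\<^sup>2) / (t + 1)\<^sup>2"
    using t by (simp add: lyapunov_def dot_square_norm pos_le_divide_eq mult.commute add.commute)
qed

end

theorem theorem3:
  fixes f :: "real ^ 'd \<Rightarrow> real"
    and xstar x0 :: "real ^ 'd"
    and M :: "'w measure"
    and T :: "nat \<Rightarrow> 'w \<Rightarrow> real"
    and X Y :: "real \<Rightarrow> 'w \<Rightarrow> real ^ 'd"
    and t :: real
  assumes "f differentiable_on UNIV"
    and "weakly_convex f"
    and "\<forall>x. f xstar \<le> f x"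
    and "well_defined_flow f"
    and "prob_space M"
    and "randomized_hamiltonian_flow M f (\<lambda>s. 6 / (s + 1)) T X Y"
    and "AE \<omega> in M. X 0 \<omega> = x0 \<and> Y 0 \<omega> = 0"
    and "t \<ge> 0"
  shows "integrable M (\<lambda>\<omega>. f (X t \<omega>) - f xstar) \<and>
    prob_space.expectation M (\<lambda>\<omega>. f (X t \<omega>) - f xstar)
      \<le> 5 * prob_space.expectation M (\<lambda>\<omega>. f (X 0 \<omega>) - f xstar + (norm (X 0 \<omega> - xstar))\<^sup>2) / (t + 1)\<^sup>2"
proof -
  interpret convex_hamiltonian_system f xstar
    using assms by unfold_locales auto
  interpret prob_space M by fact
  have X0: "X 0 \<in> borel_measurable M"
    using assms(6) by (simp add: randomized_hamiltonian_flow_def)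
  have f_meas: "f \<in> borel_measurable borel"
    by (intro borel_measurable_continuous_onI continuous_on_f)
  note [measurable] = X0 measurable_compose[OF X0 f_meas]
  have "expectation (\<lambda>\<omega>. f (X 0 \<omega>) - f xstar + (norm (X 0 \<omega> - xstar))\<^sup>2)
      = expectation (\<lambda>\<omega>. f x0 - f xstar + (norm (x0 - xstar))\<^sup>2)"
    by (rule integral_cong_AE) (use assms(7) in auto)
  then have rhs: "expectation (\<lambda>\<omega>. f (X 0 \<omega>) - f xstar + (norm (X 0 \<omega> - xstar))\<^sup>2)
      = f x0 - f xstar + (norm (x0 - xstar))\<^sup>2"
    by (simp add: prob_space)
  have gap: "0 \<le> f x0 - f xstar" using minimizer[of x0] by simp
  show ?thesis
  proof (cases "t = 0")
    case True
    \<comment> \<open>the grid needs a positive length; at time zero the bound is immediate\<close>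
    have ae: "AE \<omega> in M. f x0 - f xstar = f (X 0 \<omega>) - f xstar"
      using assms(7) by auto
    have "integrable M (\<lambda>\<omega>. f (X 0 \<omega>) - f xstar)"
      by (rule integrable_cong_AE_imp[OF integrable_const _ ae]) measurable
    moreover have "expectation (\<lambda>\<omega>. f (X 0 \<omega>) - f xstar) = f x0 - f xstar"
    proof -
      have "expectation (\<lambda>\<omega>. f (X 0 \<omega>) - f xstar) = expectation (\<lambda>\<omega>. f x0 - f xstar)"
        by (rule integral_cong_AE) (use assms(7) in auto)
      then show ?thesis by (simp add: prob_space)
    qed
    moreover have "f x0 - f xstar \<le> 5 * (f x0 - f xstar + (norm (x0 - xstar))\<^sup>2)"
    proof -
      have "0 \<le> 4 * (f x0 - f xstar) + 5 * (norm (x0 - xstar))\<^sup>2"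
        using gap by (intro add_nonneg_nonneg mult_nonneg_nonneg) simp_all
      then show ?thesis by (simp add: algebra_simps)
    qed
    ultimately show ?thesis
      unfolding rhs True by simp
  next
    case False
    with assms(8) have t: "t > 0" by simp
    have "expectation (\<lambda>\<omega>. f (X t \<omega>) - f xstar)
        \<le> (f x0 - f xstar + 5 * (norm (x0 - xstar))\<^sup>2) / (t + 1)\<^sup>2"
      by (rule randomized_hamiltonian_flow_convergence(2)[OF assms(5,6,7) t])
    also have "\<dots> \<le> 5 * (f x0 - f xstar + (norm (x0 - xstar))\<^sup>2) / (t + 1)\<^sup>2"
      using gap by (intro divide_right_mono) auto
    finally show ?thesis
      unfolding rhs using randomized_hamiltonian_flow_convergence(1)[OF assms(5,6,7) t] by blast
  qed
qed

end
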